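(* Let $d\ge 2$ and let $G=\mathbb{FM}_d$ be the free metabelian group of rank $d$, with free generators $x_1,\ldots,x_d$. For every non-trivial $m\in G'$, the $(d+1)$-tuple $(m,x_1,\ldots,x_d)$ is non-foldable. In particular $G$ has a Schreier growth gap $n^{d+1}$. Moreover this bound is sharp, i.e. there exists a faithful $G$-set $X$ with $\mathrm{vol}_{G,X}(n)\simeq n^{d+1}$.
   Context: $\mathbb{FM}_d=F_d/F_d''$ is the quotient of the free group $F_d$ of rank $d$ by its second derived subgroup; $x_1,\ldots,x_d$ denote the images of free generators of $F_d$. $G'=[G,G]$. Let $G$ be a finitely generated group, $S$ a finite symmetric generating set, and $|\cdot|_S$ the word length. A $G$-set is a non-empty set with a $G$-action (not necessarily transitive); it is faithful if only the identity of $G$ acts trivially. The growth of the action of $G$ on a $G$-set $X$ is $\mathrm{vol}_{G,X}(n)=\max_{x\in X}|\{gx : g\in G,\ |g|_S\le n\}|$. For functions $f,g$ from $\mathbb{N}$ to the non-negative reals, $f(n)\preccurlyeq g(n)$ (equivalently $g(n)\succcurlyeq f(n)$) means that there is a constant $C>0$ such that $f(n)\le C g(Cn)$ for all sufficiently large $n$; $f\simeq g$ means $f\preccurlyeq g$ and $g\preccurlyeq f$. Up to $\simeq$, $\mathrm{vol}_{G,X}$ does not depend on $S$. The group $G$ has a Schreier growth gap $f(n)$ if every faithful $G$-set $X$ satisfies $\mathrm{vol}_{G,X}(n)\succcurlyeq f(n)$. A $k$-tuple $(g_1,\ldots,g_k)\in G^k$ is non-foldable if for every faithful $G$-set $X$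 and every $n\ge 1$ there exists $x_n\in X$ such that the map $\{-n,\ldots,n\}^k\to X$, $(n_1,\ldots,n_k)\mapsto g_k^{n_k}\cdots g_1^{n_1}(x_n)$, is injective. *)

theory Defs
  imports "HOL-Algebra.Algebra"
begin

section \<open>Free groups\<close>

text \<open>
  The free group on a set \<open>A\<close> consists of the reduced words in the letters \<open>(a, b)\<close> with
  \<open>a \<in> A\<close>, where \<open>(a, True)\<close> stands for \<open>a\<close> and \<open>(a, False)\<close> for its inverse. Two words are
  multiplied by prepending the letters of the first one to the second one, one at a time from
  right to left, cancelling whenever possible.
\<close>

definition flip_letter :: "'a \<times> bool \<Rightarrow> 'a \<times> bool" where
  "flip_letter l = (fst l, \<not> snd l)"

definition reduced :: "('a \<times> bool) list \<Rightarrow> bool" where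
  "reduced w \<longleftrightarrow> successively (\<lambda>k l. l \<noteq> flip_letter k) w"

definition push :: "'a \<times> bool \<Rightarrow> ('a \<times> bool) list \<Rightarrow> ('a \<times> bool) list" where
  "push l w = (case w of [] \<Rightarrow> [l] | k # v \<Rightarrow> if k = flip_letter l then v else l # w)"

definition free_group :: "'a set \<Rightarrow> ('a \<times> bool) list monoid" where
  "free_group A =
     \<lparr>carrier = {w. reduced w \<and> fst ` set w \<subseteq> A}, monoid.mult = (\<lambda>u v. foldr push u v), one = []\<rparr>"

definition free_gen :: "'a \<Rightarrow> ('a \<times> bool) list" where
  "free_gen a = [(a, True)]"

lemma flip_flip [simp]: "flip_letter (flip_letter l) = l"
  by (simp add: flip_letter_def)

lemma fst_flip [simp]: "fst (flip_letter l) = fst l"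
  by (simp add: flip_letter_def)

lemma flip_neq [simp]: "flip_letter l \<noteq> l" "l \<noteq> flip_letter l"
  by (simp_all add: flip_letter_def prod_eq_iff)

lemma reduced_Nil [simp]: "reduced []"
  by (simp add: reduced_def)

lemma reduced_Cons: "reduced (l # w) \<longleftrightarrow> reduced w \<and> (w = [] \<or> hd w \<noteq> flip_letter l)"
  by (auto simp: reduced_def successively_Cons)

lemma reduced_push: "reduced w \<Longrightarrow> reduced (push l w)"
  by (cases w) (auto simp: push_def reduced_Cons)

lemma push_flip_push: "reduced w \<Longrightarrow> push (flip_letter l) (push l w) = w"
  by (cases w) (auto simp: push_def reduced_Cons split: list.splits)

lemma push_push_flip: "reduced w \<Longrightarrow> push l (push (flip_letter l) w) = w"
  using push_flip_push[of w "flip_letter l"] by simp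

lemma reduced_foldr_push: "reduced v \<Longrightarrow> reduced (foldr push u v)"
  by (induction u) (auto simp: reduced_push)

lemma letters_push: "set (push l w) \<subseteq> insert l (set w)"
  by (cases w) (auto simp: push_def)

lemma letters_foldr_push: "set (foldr push u v) \<subseteq> set u \<union> set v"
proof (induction u)
  case (Cons l u)
  then show ?case using letters_push[of l "foldr push u v"] by auto
qed simp

lemma foldr_push_push:
  assumes "reduced v"
  shows "foldr push (push l u) v = push l (foldr push u v)"
proof (cases u)
  case (Cons k u')
  then show ?thesis
    using assms push_push_flip[OF reduced_foldr_push[OF assms], of l u'] by (auto simp: push_def)
qed (simp add: push_def)

lemma foldr_push_assoc:
  "reduced w \<Longrightarrow> foldr push (foldr push u v) w = foldr push u (foldr push v w)"
  by (induction u) (auto simp: foldr_push_push)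

lemma foldr_push_Nil: "reduced w \<Longrightarrow> foldr push w [] = w"
  by (induction w) (auto simp: reduced_Cons push_def split: list.splits)

lemma foldr_push_inverse:
  "reduced v \<Longrightarrow> foldr push (map flip_letter (rev w)) (foldr push w v) = v"
  by (induction w arbitrary: v) (auto simp: push_flip_push reduced_foldr_push)

lemma group_free_group: "group (free_group A)"
proof (rule groupI)
  show "x \<otimes>\<^bsub>free_group A\<^esub> y \<in> carrier (free_group A)"
    if "x \<in> carrier (free_group A)" "y \<in> carrier (free_group A)" for x y
    using that letters_foldr_push[of x y] reduced_foldr_push[of y x]
    by (auto simp: free_group_def image_subset_iff)
  show "x \<otimes>\<^bsub>free_group A\<^esub> y \<otimes>\<^bsub>free_group A\<^esub> z = x \<otimes>\<^bsub>free_group A\<^esub> (y \<otimes>\<^bsub>free_group A\<^esub> z)"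
    if "z \<in> carrier (free_group A)" for x y z
    using that by (auto simp: free_group_def foldr_push_assoc)
  show "\<exists>y\<in>carrier (free_group A). y \<otimes>\<^bsub>free_group A\<^esub> x = \<one>\<^bsub>free_group A\<^esub>"
    if x: "x \<in> carrier (free_group A)" for x
  proof -
    let ?y = "foldr push (map flip_letter (rev x)) []"
    have "fst ` set (map flip_letter (rev x)) \<subseteq> A"
      using x by (auto simp: free_group_def)
    then have "?y \<in> carrier (free_group A)"
      using letters_foldr_push[of "map flip_letter (rev x)" "[]"] reduced_foldr_push[of "[]"]
      by (fastforce simp: free_group_def)
    moreover have "foldr push ?y x = []"
    proof -
      have r: "reduced x" using x by (simp add: free_group_def)
      then have "foldr push ?y x = foldr push (map flip_letter (rev x)) x"
        by (simp add: foldr_push_assoc)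
      then show ?thesis
        using foldr_push_inverse[of "[]" x] foldr_push_Nil[OF r] by simp
    qed
    ultimately show ?thesis
      by (auto simp: free_group_def)
  qed
qed (auto simp: free_group_def)

lemma free_gen_in_carrier: "a \<in> A \<Longrightarrow> free_gen a \<in> carrier (free_group A)"
  by (simp add: free_gen_def free_group_def reduced_def)

lemma free_group_universal:
  fixes G (structure) and f :: "'b \<Rightarrow> 'a"
  assumes "group G" "f \<in> A \<rightarrow> carrier G"
  shows "\<exists>h\<in>hom (free_group A) G. \<forall>a\<in>A. h (free_gen a) = f a"
proof -
  interpret group G by fact
  define t where "t = (\<lambda>l :: 'b \<times> bool. if snd l then f (fst l) else inv (f (fst l)))"
  define h where "h = (\<lambda>w. foldr (\<lambda>l x. t l \<otimes> x) w \<one>)"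
  have f: "a \<in> A \<Longrightarrow> f a \<in> carrier G" for a
    using assms(2) by auto
  have t: "fst l \<in> A \<Longrightarrow> t l \<in> carrier G" for l
    using f by (simp add: t_def)
  have t_flip: "fst l \<in> A \<Longrightarrow> t l \<otimes> t (flip_letter l) = \<one>" for l
    using f by (simp add: t_def flip_letter_def)
  have h: "fst ` set w \<subseteq> A \<Longrightarrow> h w \<in> carrier G" for w
    by (induction w) (auto simp: h_def t)
  have h_push: "h (push l w) = t l \<otimes> h w" if "fst l \<in> A" "fst ` set w \<subseteq> A" for l w
  proof (cases w)
    case (Cons k v)
    show ?thesis
    proof (cases "k = flip_letter l")
      case True
      have hv: "h v \<in> carrier G" using h that Cons by simp
      have "t l \<otimes> h w = (t l \<otimes> t (flip_letter l)) \<otimes> h v"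
        using True Cons that hv t[of l] t[of "flip_letter l"] by (simp add: h_def m_assoc)
      then show ?thesis
        using True Cons that hv t_flip by (simp add: push_def)
    qed (use Cons in \<open>simp add: push_def h_def\<close>)
  qed (simp add: push_def h_def)
  have "h (foldr push u v) = h u \<otimes> h v" if "fst ` set u \<subseteq> A" "fst ` set v \<subseteq> A" for u v
    using that
  proof (induction u)
    case Nil
    then show ?case using h[of v] by (simp add: h_def)
  next
    case (Cons l u)
    have uv: "fst ` set (foldr push u v) \<subseteq> A"
      using Cons.prems subset_trans[OF image_mono[OF letters_foldr_push[of u v], of fst]]
      by (simp add: image_Un)
    have "h (foldr push (l # u) v) = t l \<otimes> h (foldr push u v)"
      using h_push[OF _ uv, of l] Cons.prems by simp
    also have "\<dots> = (t l \<otimes> h u) \<otimes> h v"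
      using Cons h[of u] h[of v] t[of l] by (simp add: m_assoc)
    finally show ?case by (simp add: h_def)
  qed
  then have "h \<in> hom (free_group A) G"
    using h by (auto simp: hom_def free_group_def)
  moreover have "\<forall>a\<in>A. h (free_gen a) = f a"
    using f by (simp add: h_def free_gen_def t_def)
  ultimately show ?thesis by blast
qed

lemma generate_free_group: "generate (free_group A) (free_gen ` A) = carrier (free_group A)"
proof -
  interpret group "free_group A" by (rule group_free_group)
  have gens: "free_gen ` A \<subseteq> carrier (free_group A)"
    by (auto intro: free_gen_in_carrier)
  have inv_gen: "inv\<^bsub>free_group A\<^esub> (free_gen a) = [(a, False)]" if "a \<in> A" for a
  proof (rule inv_equality)
    show "[(a, False)] \<otimes>\<^bsub>free_group A\<^esub> free_gen a = \<one>\<^bsub>free_group A\<^esub>"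
      by (simp add: free_group_def free_gen_def push_def flip_letter_def)
    show "free_gen a \<in> carrier (free_group A)"
      using that by (rule free_gen_in_carrier)
    show "[(a, False)] \<in> carrier (free_group A)"
      using that by (simp add: free_group_def reduced_def)
  qed
  have letter: "[l] \<in> generate (free_group A) (free_gen ` A)" if "fst l \<in> A" for l
  proof (cases l)
    case (Pair a b)
    with that have "a \<in> A" by simp
    then show ?thesis
      using generate.incl[of "free_gen a" "free_gen ` A" "free_group A"]
        generate.inv[of "free_gen a" "free_gen ` A" "free_group A"] inv_gen Pair
      by (cases b) (auto simp: free_gen_def)
  qed
  have "w \<in> generate (free_group A) (free_gen ` A)" if "reduced w" "fst ` set w \<subseteq> A" for w
    using that
  proof (induction w)
    case Nil
    then show ?case
      using generate.one[of "free_group A"] by (simp add: free_group_def)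
  next
    case (Cons l w)
    then have "[l] \<otimes>\<^bsub>free_group A\<^esub> w \<in> generate (free_group A) (free_gen ` A)"
      by (intro generate.eng letter) (auto simp: reduced_Cons)
    moreover have "[l] \<otimes>\<^bsub>free_group A\<^esub> w = l # w"
      using Cons.prems by (cases w) (auto simp: free_group_def push_def reduced_Cons)
    ultimately show ?case by simp
  qed
  then show ?thesis
    using generate_incl[OF gens] by (auto simp: free_group_def)
qed


section \<open>Free metabelian groups\<close>

definition free_metabelian_group :: "nat \<Rightarrow> (nat \<times> bool) list set monoid" where
  "free_metabelian_group d =
     (let F = free_group {1..d} in F Mod derived F (derived F (carrier F)))"

definition free_metabelian_gen :: "nat \<Rightarrow> nat \<Rightarrow> (nat \<times> bool) list set" where
  "free_metabelian_gen d i =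
     (let F = free_group {1..d} in derived F (derived F (carrier F)) #>\<^bsub>F\<^esub> free_gen i)"

lemma second_derived_normal:
  fixes F (structure)
  assumes "group F"
  shows "derived F (derived F (carrier F)) \<lhd> F"
proof -
  interpret group F by fact
  show ?thesis
    by (intro derived_is_normal normal_self)
qed

lemma group_free_metabelian_group: "group (free_metabelian_group d)"
  unfolding free_metabelian_group_def Let_def
  by (intro normal.factorgroup_is_group second_derived_normal group_free_group)


section \<open>Growth of actions\<close>

definition finite_symmetric_generating_set :: "('g, 'm) monoid_scheme \<Rightarrow> 'g set \<Rightarrow> bool" where
  "finite_symmetric_generating_set G S \<longleftrightarrow>
     finite S \<and> S \<subseteq> carrier G \<and> (\<forall>s\<in>S. inv\<^bsub>G\<^esub> s \<in> S) \<and> generate G S = carrier G"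

definition finitely_generated :: "('g, 'm) monoid_scheme \<Rightarrow> bool" where
  "finitely_generated G \<longleftrightarrow> group G \<and> (\<exists>S. finite_symmetric_generating_set G S)"

lemma finitely_generated_free_metabelian_group: "finitely_generated (free_metabelian_group d)"
proof -
  define F where "F = free_group {1..d}"
  define N where "N = derived F (derived F (carrier F))"
  define B where "B = free_metabelian_gen d ` {1..d}"
  define S where "S = B \<union> m_inv (free_metabelian_group d) ` B"
  have FM: "free_metabelian_group d = F Mod N"
    by (simp add: free_metabelian_group_def F_def N_def Let_def)
  have N: "N \<lhd> F"
    unfolding N_def F_def by (intro second_derived_normal group_free_group)
  interpret Q: group "free_metabelian_group d" by (rule group_free_metabelian_group)
  have \<pi>: "group_hom F (free_metabelian_group d) (\<lambda>x. N #>\<^bsub>F\<^esub> x)"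
    unfolding group_hom_def group_hom_axioms_def
    using normal.r_coset_hom_Mod[OF N] FM group_free_group Q.is_group by (simp add: F_def)
  have B_img: "B = (\<lambda>x. N #>\<^bsub>F\<^esub> x) ` (free_gen ` {1..d})"
    unfolding B_def free_metabelian_gen_def F_def N_def Let_def image_image ..
  have gens: "free_gen ` {1..d} \<subseteq> carrier F"
    unfolding F_def by (auto intro: free_gen_in_carrier)
  have "carrier (free_metabelian_group d) = (\<lambda>x. N #>\<^bsub>F\<^esub> x) ` carrier F"
    by (simp add: FM carrier_FactGroup)
  also have "\<dots> = generate (free_metabelian_group d) B"
    using group_hom.generate_img[OF \<pi> gens] B_img generate_free_group[of "{1..d}"]
    by (simp add: F_def)
  finally have gen: "generate (free_metabelian_group d) B = carrier (free_metabelian_group d)"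
    by simp
  then have B: "B \<subseteq> carrier (free_metabelian_group d)"
    using generate.incl by fastforce
  have S: "S \<subseteq> carrier (free_metabelian_group d)"
    using B by (auto simp: S_def)
  have "generate (free_metabelian_group d) S = carrier (free_metabelian_group d)"
    using Q.mono_generate[of B S] Q.generate_incl[OF S] gen by (auto simp: S_def)
  moreover have "\<forall>s\<in>S. inv\<^bsub>free_metabelian_group d\<^esub> s \<in> S"
    using B by (auto simp: S_def)
  moreover have "finite S"
    by (simp add: S_def B_def)
  ultimately show ?thesis
    unfolding finitely_generated_def finite_symmetric_generating_set_def
    using S Q.is_group by blast
qed

text \<open>Since only symmetric \<open>S\<close> are used, words in the elements of \<open>S\<close> need no inverses.\<close>

definition word_length :: "('g, 'm) monoid_scheme \<Rightarrow> 'g set \<Rightarrow> 'g \<Rightarrow> nat" where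
  "word_length G S g =
     (LEAST n. \<exists>w. set w \<subseteq> S \<and> length w = n \<and> foldr (\<lambda>s x. s \<otimes>\<^bsub>G\<^esub> x) w \<one>\<^bsub>G\<^esub> = g)"

definition faithful_G_set ::
    "('g, 'm) monoid_scheme \<Rightarrow> 'x set \<Rightarrow> ('g \<Rightarrow> 'x \<Rightarrow> 'x) \<Rightarrow> bool" where
  "faithful_G_set G E \<phi> \<longleftrightarrow> E \<noteq> {} \<and> faithful_action G E \<phi>"

text \<open>The maximum is attained: the cardinalities are bounded by the size of the ball in \<open>G\<close>.\<close>

definition vol ::
    "('g, 'm) monoid_scheme \<Rightarrow> 'g set \<Rightarrow> 'x set \<Rightarrow> ('g \<Rightarrow> 'x \<Rightarrow> 'x) \<Rightarrow> nat \<Rightarrow> nat" where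
  "vol G S E \<phi> n =
     Max ((\<lambda>x. card ((\<lambda>g. \<phi> g x) ` {g \<in> carrier G. word_length G S g \<le> n})) ` E)"

text \<open>The constant is a natural number since \<open>g\<close> has to be evaluated at \<open>C * n\<close>.\<close>

definition asymp_le :: "(nat \<Rightarrow> real) \<Rightarrow> (nat \<Rightarrow> real) \<Rightarrow> bool" where
  "asymp_le f g \<longleftrightarrow> (\<exists>C::nat. C > 0 \<and> (\<forall>\<^sub>F n in sequentially. f n \<le> real C * g (C * n)))"

definition asymp_eq :: "(nat \<Rightarrow> real) \<Rightarrow> (nat \<Rightarrow> real) \<Rightarrow> bool" where
  "asymp_eq f g \<longleftrightarrow> asymp_le f g \<and> asymp_le g f"

text \<open>
  A definition cannot quantify over all types, so the type of the points of the \<open>G\<close>-sets is a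
  parameter of the following two notions. A theorem in which this parameter is a type variable
  covers all \<open>G\<close>-sets.
\<close>

definition schreier_growth_gap ::
    "'x itself \<Rightarrow> ('g, 'm) monoid_scheme \<Rightarrow> (nat \<Rightarrow> real) \<Rightarrow> bool" where
  "schreier_growth_gap _ G f \<longleftrightarrow> finitely_generated G \<and>
     (\<forall>S (E :: 'x set) \<phi>. finite_symmetric_generating_set G S \<longrightarrow> faithful_G_set G E \<phi> \<longrightarrow>
        asymp_le f (\<lambda>n. real (vol G S E \<phi> n)))"


section \<open>Non-foldable tuples\<close>

text \<open>The point \<open>g\<^sub>k\<^bsup>n\<^sub>k\<^esup> \<cdots> g\<^sub>1\<^bsup>n\<^sub>1\<^esup>(x)\<close>: the first entry of the tuple acts first.\<close>

definition tuple_act ::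
    "('g, 'm) monoid_scheme \<Rightarrow> ('g \<Rightarrow> 'x \<Rightarrow> 'x) \<Rightarrow> 'g list \<Rightarrow> int list \<Rightarrow> 'x \<Rightarrow> 'x" where
  "tuple_act G \<phi> gs ns x = fold (\<lambda>(g, n) y. \<phi> (g [^]\<^bsub>G\<^esub> n) y) (zip gs ns) x"

definition non_foldable :: "'x itself \<Rightarrow> ('g, 'm) monoid_scheme \<Rightarrow> 'g list \<Rightarrow> bool" where
  "non_foldable _ G gs \<longleftrightarrow>
     (\<forall>(E :: 'x set) \<phi>. faithful_G_set G E \<phi> \<longrightarrow>
        (\<forall>n::nat. n \<ge> 1 \<longrightarrow> (\<exists>x\<in>E.
           inj_on (\<lambda>ns. tuple_act G \<phi> gs ns x)
             {ns. length ns = length gs \<and> set ns \<subseteq> {- int n..int n}})))"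

end

theory Submission
  imports Defs
begin

text \<open>
  The Magnus embedding sends the generator \<open>x\<^sub>i\<close> to the pair consisting of the edge
  \<open>(i, 0)\<close> of the Cayley graph of \<open>\<int>\<^sup>d\<close> and the vector \<open>e\<^sub>i\<close>; its first component records
  how often a word traverses each edge. Through it, \<open>G'\<close> becomes a torsion-free group on which
  \<open>g - 1\<close> acts injectively for every \<open>g\<close> outside \<open>G'\<close>.

  A tuple that folds at a point \<open>x\<close> yields an element of a fixed finite set that fixes \<open>x\<close>: either
  a power \<open>m\<^sup>k\<close> or some \<open>h\<close> outside \<open>G'\<close>. If every point of the \<open>G'\<close>-orbit of \<open>x\<close> is fixed by
  some such \<open>h\<close>, then \<open>G'\<close> is covered by finitely many cosets of the subgroups
  \<open>{u. (h - 1) u fixes x}\<close>, so one of these contains all \<open>N!\<close>-th powers. Applying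
  all the operators \<open>h - 1\<close> to a suitable power of \<open>m\<close> then gives a non-trivial element acting
  trivially everywhere.

  For the upper bound, \<open>G\<close> acts on \<open>d\<close> copies of \<open>\<int> \<times> \<int>\<^sup>d\<close>, the copy \<open>j\<close> counting the traversals
  of edges in direction \<open>j\<close>.
\<close>

section \<open>Points moved by finitely many elements\<close>

text \<open>
  A quantitative form of Neumann's lemma. If it fails with witnesses \<open>u i\<close>, then among the
  \<open>(N + 1)^N\<close> products \<open>\<Prod> (u i)^(t i)\<close> with exponents at most \<open>N\<close>, every line in direction \<open>i\<close>
  meets \<open>B i\<close> at most once.
\<close>

lemma (in comm_group) finite_cover_power:
  assumes fin: "finite I"
    and sub: "\<And>i. i \<in> I \<Longrightarrow> subgroup (K i) G"
    and cover: "carrier G \<subseteq> (\<Union>i\<in>I. B i)"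
    and diff: "\<And>i v w. \<lbrakk>i \<in> I; v \<in> carrier G; w \<in> carrier G; v \<in> B i; v \<otimes> w \<in> B i\<rbrakk> \<Longrightarrow> w \<in> K i"
  shows "\<exists>i\<in>I. \<forall>u\<in>carrier G. u [^] (fact (card I) :: nat) \<in> K i"
proof (rule ccontr)
  define N where "N = card I"
  assume "\<not> ?thesis"
  then have "\<forall>i\<in>I. \<exists>u\<in>carrier G. u [^] (fact N :: nat) \<notin> K i"
    by (auto simp: N_def)
  then obtain u where u: "\<And>i. i \<in> I \<Longrightarrow> u i \<in> carrier G"
    "\<And>i. i \<in> I \<Longrightarrow> u i [^] (fact N :: nat) \<notin> K i"
    by metis
  define T where "T = (I \<rightarrow>\<^sub>E {..N})"
  define v where "v t = (\<Otimes>i\<in>I. u i [^] (t i :: nat))" for t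
  have v: "v t \<in> carrier G" for t
    unfolding v_def using u by (intro finprod_closed) auto
  \<comment> \<open>Two exponent vectors on one line in direction \<open>i\<close> differ by some
    \<open>k\<close> with \<open>1 <= k <= N\<close>. If both products lay in \<open>B i\<close>,
    then \<open>u i [^] k\<close> would lie in \<open>K i\<close>, and so would
    \<open>u i [^] fact N\<close>, because \<open>k\<close> divides \<open>fact N\<close>.\<close>
  have distinct: False
    if i: "i \<in> I" and t: "t \<in> T" "t' \<in> T" "v t \<in> B i" "v t' \<in> B i"
      and off: "\<And>j. j \<in> I - {i} \<Longrightarrow> t j = t' j" and less: "t i < t' i" for i t t'
  proof -
    define k where "k = t' i - t i"
    have k: "0 < k" "k \<le> N" "t' i = k + t i"
      using less t i by (auto simp: k_def T_def PiE_iff intro: le_trans)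
    define P where "P = (\<Otimes>j\<in>I - {i}. u j [^] t j)"
    have P: "P \<in> carrier G"
      unfolding P_def using u by (intro finprod_closed) auto
    have split: "v s = u i [^] s i \<otimes> (\<Otimes>j\<in>I - {i}. u j [^] s j)" for s :: "_ \<Rightarrow> nat"
      unfolding v_def using u i fin finprod_insert[of "I - {i}" i "\<lambda>j. u j [^] s j"]
      by (simp add: insert_absorb Pi_iff)
    have "(\<Otimes>j\<in>I - {i}. u j [^] t' j) = P"
      unfolding P_def using off u by (intro finprod_cong') auto
    then have "v t' = u i [^] t' i \<otimes> P"
      using split by simp
    also have "\<dots> = v t \<otimes> u i [^] k"
      using split[of t] u(1)[OF i] P
      by (simp add: k(3) nat_pow_mult[symmetric] P_def[symmetric] m_ac)
    finally have "u i [^] k \<in> K i"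
      using diff[OF i v[of t], of "u i [^] k"] t u(1)[OF i] by simp
    then have "(u i [^] k) [^] (fact N div k :: nat) \<in> K i"
      using sub[OF i] by (metis subgroup_int_pow_closed int_pow_int)
    moreover have "k * (fact N div k) = fact N"
      using k dvd_fact[of k N] by simp
    ultimately show False
      using u[OF i] by (simp add: nat_pow_pow)
  qed
  have count: "card {t \<in> T. v t \<in> B i} \<le> Suc N ^ (N - 1)" if i: "i \<in> I" for i
  proof -
    \<comment> \<open>Restricting to the other coordinates names the line, which by
      \<open>distinct\<close> meets \<open>B i\<close> at most once; there are
      \<open>(N + 1)^(N - 1)\<close> lines.\<close>
    have "inj_on (\<lambda>t. restrict t (I - {i})) {t \<in> T. v t \<in> B i}"
    proof (rule inj_onI)
      fix t t' assume t: "t \<in> {t \<in> T. v t \<in> B i}" "t' \<in> {t \<in> T. v t \<in> B i}"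
        and eq: "restrict t (I - {i}) = restrict t' (I - {i})"
      have off: "t j = t' j" if "j \<in> I - {i}" for j
        using fun_cong[OF eq, of j] that by simp
      have "t i = t' i"
        using distinct[OF i, of t t'] distinct[OF i, of t' t] t off by (metis (lifting) mem_Collect_eq linorder_neqE_nat)
      then have "t j = t' j" if "j \<in> I" for j
        using off[of j] that by (cases "j = i") auto
      then show "t = t'"
        using t unfolding T_def by (intro PiE_ext[of t I _ t']) auto
    qed
    moreover have "(\<lambda>t. restrict t (I - {i})) ` {t \<in> T. v t \<in> B i} \<subseteq> (I - {i} \<rightarrow>\<^sub>E {..N})"
      by (force simp: T_def PiE_iff)
    ultimately have "card {t \<in> T. v t \<in> B i} \<le> card (I - {i} \<rightarrow>\<^sub>E {..N})"
      using fin by (intro card_inj_on_le[of "\<lambda>t. restrict t (I - {i})"] finite_PiE) auto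
    also have "\<dots> = Suc N ^ (N - 1)"
      using fin i by (simp add: card_PiE N_def)
    finally show ?thesis .
  qed
  have "T \<subseteq> (\<Union>i\<in>I. {t \<in> T. v t \<in> B i})"
    using cover v by blast
  moreover have finT: "finite T"
    using fin by (auto simp: T_def intro: finite_PiE)
  ultimately have "card T \<le> card (\<Union>i\<in>I. {t \<in> T. v t \<in> B i})"
    using fin by (intro card_mono) auto
  also have "\<dots> \<le> (\<Sum>i\<in>I. card {t \<in> T. v t \<in> B i})"
    using fin by (rule card_UN_le)
  also have "\<dots> \<le> N * Suc N ^ (N - 1)"
    using sum_bounded_above[of I "\<lambda>i. card {t \<in> T. v t \<in> B i}"] count by (simp add: N_def)
  \<comment> \<open>For \<open>N = 0\<close> this reads \<open>0 < 1\<close>, so an empty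
    \<open>I\<close> is covered as well.\<close>
  also have "\<dots> < Suc N ^ N"
    by (cases N) auto
  also have "\<dots> = card T"
    using fin by (simp add: T_def card_PiE N_def)
  finally show False by simp
qed

text \<open>Written additively, \<open>M\<close> is a module over the integral group ring of the
  abelian group \<open>G/M\<close>. The last two assumptions say that it has no additive torsion and
  that \<open>g - 1\<close> acts injectively for \<open>g\<close> outside \<open>M\<close>.\<close>

locale metabelian_tf = normal M G for M and G (structure) +
  assumes M_comm: "\<lbrakk>u \<in> M; v \<in> M\<rbrakk> \<Longrightarrow> u \<otimes> v = v \<otimes> u"
    and comm_in_M: "\<lbrakk>g \<in> carrier G; h \<in> carrier G\<rbrakk> \<Longrightarrow> g \<otimes> h \<otimes> inv g \<otimes> inv h \<in> M"
    and torsion_free: "\<lbrakk>u \<in> M; u [^] (n::nat) = \<one>; 0 < n\<rbrakk> \<Longrightarrow> u = \<one>"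
    and centralizer: "\<lbrakk>g \<in> carrier G; g \<notin> M; u \<in> M; g \<otimes> u \<otimes> inv g = u\<rbrakk> \<Longrightarrow> u = \<one>"
begin

section \<open>Conjugation and the operators g - 1 on M\<close>

definition conj :: "'a \<Rightarrow> 'a \<Rightarrow> 'a" where
  "conj g u = g \<otimes> u \<otimes> inv g"

text \<open>The operator \<open>u \<mapsto> (g - 1) u\<close> in module notation.\<close>

definition delta :: "'a \<Rightarrow> 'a \<Rightarrow> 'a" where
  "delta g u = conj g u \<otimes> inv u"

sublocale MG: comm_group "G\<lparr>carrier := M\<rparr>"
  using subgroup_is_group[OF is_group] by (rule group.group_comm_groupI) (simp add: M_comm)

lemma conj_closed: "\<lbrakk>g \<in> carrier G; u \<in> M\<rbrakk> \<Longrightarrow> conj g u \<in> M"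
  unfolding conj_def by (rule inv_op_closed2)

lemma inv_M [simp]: "u \<in> M \<Longrightarrow> inv\<^bsub>G\<lparr>carrier := M\<rparr>\<^esub> u = inv u"
  by (rule m_inv_consistent[OF subgroup_axioms])

lemma conj_mult: "\<lbrakk>g \<in> carrier G; u \<in> M; v \<in> M\<rbrakk> \<Longrightarrow> conj g (u \<otimes> v) = conj g u \<otimes> conj g v"
  by (simp add: conj_def m_assoc inv_solve_left)

lemma conj_comp: "\<lbrakk>g \<in> carrier G; h \<in> carrier G; u \<in> M\<rbrakk> \<Longrightarrow> conj g (conj h u) = conj (g \<otimes> h) u"
  by (simp add: conj_def m_assoc inv_mult_group)

lemma conj_M: "\<lbrakk>w \<in> M; u \<in> M\<rbrakk> \<Longrightarrow> conj w u = u"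
  by (simp add: conj_def M_comm[of w u] m_assoc)

text \<open>\<open>g h\<close> and \<open>h g\<close> differ by a commutator, which lies in
  \<open>M\<close> and therefore acts trivially on the abelian group \<open>M\<close>.\<close>

lemma conj_commute:
  assumes "g \<in> carrier G" "h \<in> carrier G" "u \<in> M"
  shows "conj g (conj h u) = conj h (conj g u)"
proof -
  let ?w = "inv h \<otimes> inv g \<otimes> h \<otimes> g"
  have w: "?w \<in> M"
    using comm_in_M[of "inv h" "inv g"] assms by simp
  have "conj g (conj h u) = conj g (conj h (conj ?w u))"
    using conj_M[OF w] assms by simp
  also have "\<dots> = conj (g \<otimes> h \<otimes> ?w) u"
    using assms mem_carrier[OF w] conj_closed[OF _ assms(3)] by (simp add: conj_comp m_assoc)
  also have "g \<otimes> h \<otimes> ?w = h \<otimes> g"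
  proof -
    have "?w = inv (g \<otimes> h) \<otimes> (h \<otimes> g)"
      using assms by (simp add: inv_mult_group m_assoc)
    then show ?thesis
      using assms by (simp add: m_assoc[of "g \<otimes> h", symmetric] del: inv_mult_group)
  qed
  finally show ?thesis
    using assms by (simp add: conj_comp)
qed

lemma conj_hom: "g \<in> carrier G \<Longrightarrow> conj g \<in> hom (G\<lparr>carrier := M\<rparr>) (G\<lparr>carrier := M\<rparr>)"
  by (auto simp: hom_def conj_closed conj_mult)

lemma delta_closed: "\<lbrakk>g \<in> carrier G; u \<in> M\<rbrakk> \<Longrightarrow> delta g u \<in> M"
  by (simp add: delta_def conj_closed)

lemma delta_hom: 
  assumes g: "g \<in> carrier G" 
  shows "delta g \<in> hom (G\<lparr>carrier := M\<rparr>) (G\<lparr>carrier := M\<rparr>)"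
proof (rule homI)
  fix u v assume "u \<in> carrier (G\<lparr>carrier := M\<rparr>)" "v \<in> carrier (G\<lparr>carrier := M\<rparr>)"
  then have uv: "u \<in> M" "v \<in> M" by auto
  have "delta g (u \<otimes> v) = conj g u \<otimes> conj g v \<otimes>  inv u \<otimes> inv v"
    using uv g conj_closed[OF g] 
    by (simp add: delta_def conj_mult inv_mult_group m_assoc M_comm[of "inv v" "inv u"])
  also have "\<dots> = delta g u \<otimes> delta g v"
    using uv g conj_closed[OF g]
    by (simp add: delta_def m_assoc) (simp add: m_assoc[symmetric] M_comm[of "conj g v" "inv u"])
  finally show "delta g (u \<otimes>\<^bsub>G\<lparr>carrier := M\<rparr>\<^esub> v) = delta g u \<otimes>\<^bsub>G\<lparr>carrier := M\<rparr>\<^esub> delta g v"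
    by simp
qed (use g delta_closed in auto)

lemma hom_inv:
  assumes "f \<in> hom (G\<lparr>carrier := M\<rparr>) (G\<lparr>carrier := M\<rparr>)" "u \<in> M"
  shows "f (inv u) = inv (f u)"
proof -
  have "group_hom (G\<lparr>carrier := M\<rparr>) (G\<lparr>carrier := M\<rparr>) f"
    using assms MG.is_group by (simp add: group_hom_def group_hom_axioms_def)
  from group_hom.hom_inv[OF this, of u] assms(2) show ?thesis
    using assms by (simp add: hom_def Pi_iff)
qed

lemma hom_pow:
  assumes "f \<in> hom (G\<lparr>carrier := M\<rparr>) (G\<lparr>carrier := M\<rparr>)" "u \<in> M"
  shows "f (u [^] (n::nat)) = f u [^] n"
proof -
  have "group_hom (G\<lparr>carrier := M\<rparr>) (G\<lparr>carrier := M\<rparr>) f"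
    using assms MG.is_group by (simp add: group_hom_def group_hom_axioms_def)
  from group_hom.hom_nat_pow[OF this, of u n] assms(2) show ?thesis
    by (simp add: nat_pow_consistent[symmetric])
qed

lemma delta_conj:
  assumes "g \<in> carrier G" "h \<in> carrier G" "u \<in> M"
  shows "delta h (conj g u) = conj g (delta h u)"
  using assms hom_inv[OF conj_hom[OF assms(1)], of u]
  by (simp add: delta_def conj_mult conj_closed conj_commute[of h g])

text \<open>\<open>delta h\<close> is a homomorphism commuting with \<open>conj g\<close>, so it can
  be applied to both factors of \<open>delta g u\<close>.\<close>

lemma delta_delta:
  assumes "g \<in> carrier G" "h \<in> carrier G" "u \<in> M"
  shows "delta h (delta g u) = delta g (delta h u)"
proof -
  have "delta h (delta g u) = delta h (conj g u) \<otimes> inv (delta h u)"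
    using assms hom_mult[OF delta_hom[OF assms(2)], of "conj g u" "inv u"]
      hom_inv[OF delta_hom[OF assms(2)], of u]
    by (simp add: delta_def[of g] conj_closed)
  then show ?thesis
    using assms by (simp add: delta_conj delta_def[of g])
qed

lemma delta_eq_one: "\<lbrakk>g \<in> carrier G; g \<notin> M; u \<in> M; delta g u = \<one>\<rbrakk> \<Longrightarrow> u = \<one>"
  using centralizer[of g u] conj_closed[of g u] inv_solve_right'[of \<one> "conj g u" u]
  by (auto simp: delta_def conj_def)


lemma foldr_delta_closed:
  "\<lbrakk>set hs \<subseteq> carrier G; u \<in> M\<rbrakk> \<Longrightarrow> foldr delta hs u \<in> M"
  by (induction hs) (auto simp: delta_closed)

text \<open>The operators commute, so any one of them can be brought to the front: the composite has
  its values in the image of each.\<close>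

lemma foldr_delta_factor:
  "\<lbrakk>set hs \<subseteq> carrier G; u \<in> M; h \<in> set hs\<rbrakk> \<Longrightarrow> \<exists>v\<in>M. foldr delta hs u = delta h v"
proof (induction hs)
  case (Cons k hs)
  show ?case
  proof (cases "h = k")
    case True
    then show ?thesis using Cons.prems foldr_delta_closed[of hs u] by auto
  next
    case False
    then obtain v where "v \<in> M" "foldr delta hs u = delta h v"
      using Cons by auto
    then show ?thesis
      using Cons.prems delta_delta[of h k v] delta_closed[of k v] by auto
  qed
qed simp

lemma foldr_delta_conj:
  "\<lbrakk>set hs \<subseteq> carrier G; u \<in> M; g \<in> carrier G\<rbrakk>
    \<Longrightarrow> conj g (foldr delta hs u) = foldr delta hs (conj g u)"
  by (induction hs) (auto simp: delta_conj[symmetric] foldr_delta_closed)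

text \<open>Each operator has trivial kernel by \<open>delta_eq_one\<close>.\<close>

lemma foldr_delta_neq_one:
  "\<lbrakk>set hs \<subseteq> carrier G - M; u \<in> M; u \<noteq> \<one>\<rbrakk> \<Longrightarrow> foldr delta hs u \<noteq> \<one>"
proof (induction hs)
  case (Cons h hs)
  then show ?case
    using delta_eq_one[of h "foldr delta hs u"] foldr_delta_closed[of hs u] by auto
qed simp

lemma nat_pow_neq_one: "\<lbrakk>u \<in> M; u \<noteq> \<one>; 0 < n\<rbrakk> \<Longrightarrow> u [^] (n::nat) \<noteq> \<one>"
  using torsion_free by blast

lemma pow_in_M: "u \<in> M \<Longrightarrow> u [^] (n::nat) \<in> M"
  using MG.nat_pow_closed[of u n] by (simp add: nat_pow_consistent[symmetric])

text \<open>
  Here \<open>z\<close> is the element that acts trivially on all of \<open>E\<close>. If some translate \<open>g x\<close> is moved by all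
  \<open>m^k\<close>, this is because \<open>conj g z\<close> lies in the image of every \<open>delta h\<close> on \<open>N!\<close>-th powers;
  otherwise because all conjugates of \<open>p\<close> fix \<open>x\<close>.
\<close>

lemma exists_moved_point:
  assumes act: "faithful_action G E \<phi>"
    and H: "finite H" "H \<subseteq> carrier G - M"
    and m: "m \<in> M" "m \<noteq> \<one>"
  shows "\<exists>x\<in>E. (\<forall>h\<in>H. \<phi> h x \<noteq> x) \<and> (\<forall>k\<in>{1..L}. \<phi> (m [^] (k::nat)) x \<noteq> x)"
proof (rule ccontr)
  assume neg: "\<not> ?thesis"
  interpret A: faithful_action G E \<phi> by (rule act)
  define N where "N = card H"
  have bad: "\<exists>h\<in>H. \<phi> h x = x" if "x \<in> E" "\<forall>k\<in>{1..L}. \<phi> (m [^] k) x \<noteq> x" for x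
    using neg that by blast
  have \<phi>E: "\<phi> g x \<in> E" if "g \<in> carrier G" "x \<in> E" for g x
    using A.element_image that by blast
  have \<phi>_inj: "\<phi> g x = \<phi> g y \<longleftrightarrow> x = y" if "g \<in> carrier G" "x \<in> E" "y \<in> E" for g x y
    using A.inj_prop[of g] that by (auto dest: inj_onD)
  have \<phi>_inv: "\<phi> (inv g) x = x" if "g \<in> carrier G" "x \<in> E" "\<phi> g x = x" for g x
    using A.orbit_sym_aux[OF that] .
  have comm: "\<phi> u (\<phi> v x) = \<phi> v (\<phi> u x)" if "u \<in> M" "v \<in> M" "x \<in> E" for u v x
    using that A.composition_rule[of x u v] A.composition_rule[of x v u] M_comm[of u v] by simp
  have fix_pow: "\<phi> (g [^] n) x = x" if "g \<in> carrier G" "x \<in> E" "\<phi> g x = x" for g x and n :: nat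
  proof (induction n)
    case 0
    then show ?case using A.id_eq_one that by (metis nat_pow_0 restrict_apply')
  next
    case (Suc n)
    then show ?case using that A.composition_rule[of x "g [^] n" g] by simp
  qed

  \<comment> \<open>Powers of \<open>m\<close> commute with \<open>M\<close>, so every translate of
    \<open>x\<close> by some \<open>v\<close> in \<open>M\<close> is again moved by all
    \<open>m [^] k\<close> and, by \<open>bad\<close>, fixed by some \<open>h\<close>. Hence the
    sets \<open>B h\<close> cover \<open>M\<close>, and \<open>finite_cover_power\<close>
    applies.\<close>
  have moving: "\<exists>h\<in>H. \<forall>u\<in>M. \<phi> (delta h (u [^] (fact N :: nat))) x = x"
    if x: "x \<in> E" "\<forall>k\<in>{1..L}. \<phi> (m [^] k) x \<noteq> x" for x
  proof -
    define K where "K h = {w \<in> M. \<phi> (delta h w) x = x}" for h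
    define B where "B h = {v \<in> M. \<phi> h (\<phi> v x) = \<phi> v x}" for h
    have "\<exists>h\<in>H. \<forall>u\<in>carrier (G\<lparr>carrier := M\<rparr>).
        u [^]\<^bsub>G\<lparr>carrier := M\<rparr>\<^esub> (fact (card H) :: nat) \<in> K h"
    proof (rule MG.finite_cover_power[OF H(1)])
      show "carrier (G\<lparr>carrier := M\<rparr>) \<subseteq> (\<Union>h\<in>H. B h)"
      proof
        fix v assume "v \<in> carrier (G\<lparr>carrier := M\<rparr>)"
        then have v: "v \<in> M" by simp
        have "\<phi> (m [^] k) (\<phi> v x) \<noteq> \<phi> v x" if "k \<in> {1..L}" for k
          using that x comm[of "m [^] k" v x] pow_in_M[OF m(1)] v \<phi>E[of "m [^] k" x] \<phi>_inj[of v "\<phi> (m [^] k) x" x]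
          by simp
        then have "\<exists>h\<in>H. \<phi> h (\<phi> v x) = \<phi> v x"
          using bad[of "\<phi> v x"] \<phi>E[of v x] x v by simp
        then show "v \<in> (\<Union>h\<in>H. B h)" using v by (auto simp: B_def)
      qed
    next
      fix h assume "h \<in> H"
      then have h: "h \<in> carrier G" using H by auto
      have dl: "delta h u \<in> carrier G" if "u \<in> M" for u
        using delta_closed[OF h that] by simp
      show "subgroup (K h) (G\<lparr>carrier := M\<rparr>)"
      proof (rule MG.subgroupI)
        have "\<phi> (delta h \<one>) x = x"
          using x A.id_eq_one h by (simp add: delta_def conj_def flip: A.id_eq_one)
        then have "\<one> \<in> K h" using subgroup.one_closed[OF subgroup_axioms] by (simp add: K_def)
        then show "K h \<noteq> {}" by blast
        show "inv\<^bsub>G\<lparr>carrier := M\<rparr>\<^esub> u \<in> K h" if "u \<in> K h" for u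
          using that x h \<phi>_inv[of "delta h u" x] dl by (auto simp: K_def hom_inv[OF delta_hom])
        show "u \<otimes>\<^bsub>G\<lparr>carrier := M\<rparr>\<^esub> v \<in> K h" if "u \<in> K h" "v \<in> K h" for u v
          using that x h dl A.composition_rule[of x "delta h u" "delta h v"] hom_mult[OF delta_hom[OF h], of u v]
          by (auto simp: K_def)
      qed (auto simp: K_def)
      fix v w assume "v \<in> carrier (G\<lparr>carrier := M\<rparr>)" "w \<in> carrier (G\<lparr>carrier := M\<rparr>)"
        and vB: "v \<in> B h" "v \<otimes>\<^bsub>G\<lparr>carrier := M\<rparr>\<^esub> w \<in> B h"
      then have v: "v \<in> M" and w: "w \<in> M" by auto
      define y where "y = \<phi> v x"
      have y: "y \<in> E" "\<phi> h y = y" using vB x v \<phi>E by (auto simp: y_def B_def)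
      have wy: "\<phi> h (\<phi> w y) = \<phi> w y"
        using vB x v w A.composition_rule[of x w v] M_comm[of v w] by (auto simp: y_def B_def)
      \<comment> \<open>In this order the four factors return \<open>y\<close> to itself, as
        \<open>h\<close> fixes both \<open>y\<close> and its image under \<open>w\<close>. Commuting
        with \<open>v\<close> carries the conclusion from \<open>y\<close> back to
        \<open>x\<close>.\<close>
      have "delta h w = inv w \<otimes> (h \<otimes> w \<otimes> inv h)"
        using conj_closed[OF h w] w M_comm[of "conj h w" "inv w"] by (simp add: delta_def conj_def)
      then have "\<phi> (delta h w) y = \<phi> (inv w) (\<phi> h (\<phi> w (\<phi> (inv h) y)))"
        using y h w \<phi>E by (simp add: A.composition_rule)
      also have "\<dots> = y"
        using y h w wy \<phi>_inv A.orbit_sym_aux[of w y] by simp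
      finally have "\<phi> v (\<phi> (delta h w) x) = \<phi> v x"
        using comm[of v "delta h w" x] v w x h delta_closed by (simp add: y_def)
      then show "w \<in> K h"
        using \<phi>_inj[of v "\<phi> (delta h w) x" x] v w x dl \<phi>E by (simp add: K_def)
    qed
    then show ?thesis
      by (auto simp: K_def N_def nat_pow_consistent[symmetric])
  qed

  obtain hs where hs: "set hs = H"
    using finite_list[OF H(1)] by blast
  then have hsG: "set hs \<subseteq> carrier G" "set hs \<subseteq> carrier G - M" using H by auto
  \<comment> \<open>\<open>p\<close> is a power of every \<open>m [^] k\<close> with
    \<open>1 <= k <= L\<close>, \<open>q\<close> lies in the image of every \<open>delta h\<close>,
    and the last exponent \<open>fact N\<close> matches the one in \<open>moving\<close>.\<close>
  define p where "p = m [^] (fact L :: nat)"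
  define q where "q = foldr delta hs p"
  define z where "z = q [^] (fact N :: nat)"
  have p: "p \<in> M" "p \<noteq> \<one>"
    using m by (auto simp: p_def pow_in_M nat_pow_neq_one)
  have q: "q \<in> M" "q \<noteq> \<one>"
    using p hsG foldr_delta_closed foldr_delta_neq_one by (auto simp: q_def)
  have z: "z \<in> M" "z \<noteq> \<one>"
    using q by (auto simp: z_def pow_in_M nat_pow_neq_one)
  \<comment> \<open>\<open>conj g\<close> commutes with all the operators, so
    \<open>conj g q\<close> is still in the image of \<open>delta h\<close>; the power passes
    through both homomorphisms.\<close>
  have conj_z: "\<exists>v\<in>M. conj g z = delta h (v [^] (fact N :: nat))" if gh: "g \<in> carrier G" "h \<in> H" for g h
  proof -
    have "conj g q = foldr delta hs (conj g p)"
      unfolding q_def using foldr_delta_conj hsG p gh by blast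
    then obtain v where "v \<in> M" "conj g q = delta h v"
      using foldr_delta_factor[OF hsG(1) conj_closed[OF gh(1) p(1)]] gh hs by metis
    moreover have "h \<in> carrier G" using gh H by auto
    ultimately show ?thesis
      using gh q hom_pow[OF conj_hom, of g q] hom_pow[OF delta_hom, of h v]
      by (intro bexI[of _ v]) (simp_all add: z_def)
  qed
  have "\<phi> z x = x" if x: "x \<in> E" for x
  proof (cases "\<exists>g\<in>carrier G. \<forall>k\<in>{1..L}. \<phi> (m [^] k) (\<phi> g x) \<noteq> \<phi> g x")
    case True
    then obtain g where g: "g \<in> carrier G" "\<forall>k\<in>{1..L}. \<phi> (m [^] k) (\<phi> g x) \<noteq> \<phi> g x"
      by blast
    then obtain h where h: "h \<in> H" "\<forall>u\<in>M. \<phi> (delta h (u [^] (fact N :: nat))) (\<phi> g x) = \<phi> g x"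
      using moving[of "\<phi> g x"] \<phi>E x by blast
    then have "\<phi> (conj g z) (\<phi> g x) = \<phi> g x"
      using conj_z[OF g(1) h(1)] by auto
    moreover have "\<phi> (conj g z) (\<phi> g x) = \<phi> (conj g z \<otimes> g) x"
      using A.composition_rule[of x "conj g z" g] g x z conj_closed by simp
    moreover have "conj g z \<otimes> g = g \<otimes> z"
      using g z by (simp add: conj_def m_assoc)
    ultimately show ?thesis
      using A.composition_rule[of x g z] g x z \<phi>_inj[of g "\<phi> z x" x] \<phi>E[of z x] by simp
  next
    case False
    \<comment> \<open>Now each point of the orbit of \<open>x\<close> is fixed by some
      \<open>m [^] k\<close>, hence by \<open>p\<close>. The pointwise stabilizer \<open>U\<close>
      of the orbit in \<open>M\<close> is closed under all the operators, so it contains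
      \<open>q\<close>.\<close>
    define U where "U = {u \<in> M. \<forall>g\<in>carrier G. \<phi> u (\<phi> g x) = \<phi> g x}"
    have "p \<in> U"
      unfolding U_def
    proof (intro CollectI conjI ballI p)
      fix g assume g: "g \<in> carrier G"
      then obtain k where k: "k \<in> {1..L}" "\<phi> (m [^] k) (\<phi> g x) = \<phi> g x" 
        using False by blast
      then have "p = (m [^] k) [^] (fact L div k :: nat)"
        using m dvd_fact[of k L] by (simp add: p_def nat_pow_pow)
      then show "\<phi> p (\<phi> g x) = \<phi> g x"
        using fix_pow[of "m [^] k" "\<phi> g x"] k g x m \<phi>E by simp
    qed
    have U_delta: "delta h u \<in> U" if u: "u \<in> U" and h: "h \<in> carrier G" for h u
      unfolding U_def
    proof (intro CollectI conjI ballI)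
      have uM: "u \<in> M" using u by (simp add: U_def)
      show "delta h u \<in> M" using uM h by (rule delta_closed[rotated])
      fix g assume g: "g \<in> carrier G"
      have "\<phi> (delta h u) (\<phi> g x) = \<phi> h (\<phi> u (\<phi> (inv h) (\<phi> (inv u) (\<phi> g x))))"
        using uM h g x \<phi>E by (simp add: delta_def conj_def A.composition_rule)
      also have "\<phi> (inv u) (\<phi> g x) = \<phi> g x"
        using u g x \<phi>E \<phi>_inv[of u "\<phi> g x"] by (simp add: U_def)
      also have "\<phi> (inv h) (\<phi> g x) = \<phi> (inv h \<otimes> g) x"
        using h g x by (simp add: A.composition_rule)
      also have "\<phi> u \<dots> = \<dots>"
        using u h g by (simp add: U_def)
      also have "\<phi> h \<dots> = \<phi> (h \<otimes> (inv h \<otimes> g)) x"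
        using h g x by (simp add: A.composition_rule)
      also have "h \<otimes> (inv h \<otimes> g) = g"
        using h g by (simp add: m_assoc[symmetric])
      finally show "\<phi> (delta h u) (\<phi> g x) = \<phi> g x" .
    qed
    have "set ks \<subseteq> carrier G \<Longrightarrow> foldr delta ks p \<in> U" for ks
      using \<open>p \<in> U\<close> U_delta by (induction ks) auto
    then have "q \<in> U" using hsG by (simp add: q_def)
    then have "\<phi> q (\<phi> \<one> x) = \<phi> \<one> x" by (simp add: U_def)
    then have "\<phi> q x = x" using x by (simp flip: A.id_eq_one)
    then show ?thesis
      using fix_pow[of q x] q x by (simp add: z_def)
  qed
  \<comment> \<open>Group elements act by functions that are extensional on \<open>E\<close>, so
    agreement on \<open>E\<close> gives equal functions, against faithfulness.\<close>
  then have "\<phi> z = \<phi> \<one>"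
    using A.bij_prop0[of z] z by (intro extensionalityI[of _ E]) (auto simp: Bij_def simp flip: A.id_eq_one)
  then show False
    using A.faithful z by (auto dest: inj_onD)
qed

end

section \<open>The Magnus embedding\<close>

text \<open>
  The edge of the Cayley graph starting at \<open>c\<close> in direction \<open>j\<close> is \<open>(j, c)\<close>. All directions in
  \<^typ>\<open>nat\<close> are allowed; those outside \<open>{1..d}\<close> do not occur in the image of the group.
\<close>

definition shift :: "(nat \<Rightarrow>\<^sub>0 int) \<Rightarrow> (nat \<times> (nat \<Rightarrow>\<^sub>0 int) \<Rightarrow>\<^sub>0 int) \<Rightarrow> (nat \<times> (nat \<Rightarrow>\<^sub>0 int) \<Rightarrow>\<^sub>0 int)" where
  "shift a = frag_extend (\<lambda>(j, c). frag_of (j, a + c))"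

lemma shift_frag_of [simp]: "shift a (frag_of (j, c)) = frag_of (j, a + c)"
  by (simp add: shift_def)

lemma shift_zero_right [simp]: "shift a 0 = 0"
  by (simp add: shift_def)

lemma shift_add: "shift a (f + g) = shift a f + shift a g"
  by (simp add: shift_def frag_extend_add)

lemma shift_diff: "shift a (f - g) = shift a f - shift a g"
  by (simp add: shift_def frag_extend_diff)

lemma shift_minus: "shift a (- f) = - shift a f"
  by (simp add: shift_def frag_extend_minus)

lemma shift_shift: "shift a (shift b f) = shift (a + b) f"
  using subset_UNIV by (induction f rule: frag_induction) (auto simp: shift_diff add.assoc)

lemma shift_zero [simp]: "shift 0 f = f"
  using subset_UNIV by (induction f rule: frag_induction) (auto simp: shift_diff)

lemma lookup_shift: "Poly_Mapping.lookup (shift a f) (j, c) = Poly_Mapping.lookup f (j, c - a)"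
  using subset_UNIV by (induction f rule: frag_induction) (auto simp: shift_diff lookup_minus diff_eq_eq add.commute)

text \<open>The support is finite, yet invariance makes it contain all vertices
  \<open>c - n a\<close> in one direction, and these are distinct because \<open>a\<close> has
  infinite order.\<close>

lemma shift_invariant_imp_zero:
  assumes "shift a f = f" "a \<noteq> 0"
  shows "f = 0"
proof (rule ccontr)
  assume "f \<noteq> 0"
  then obtain j c where jc: "(j, c) \<in> Poly_Mapping.keys f"
    by (metis keys_eq_empty ex_in_conv surj_pair)
  obtain i where i: "Poly_Mapping.lookup a i \<noteq> 0"
    using assms(2) by (metis lookup_zero poly_mapping_eqI)
  define p where "p n = (j, c - frag_cmul (int n) a)" for n :: nat
  have "p n \<in> Poly_Mapping.keys f" for n
  proof (induction n)
    case 0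
    then show ?case using jc by (simp add: p_def)
  next
    case (Suc n)
    have "Poly_Mapping.lookup f (p (Suc n)) = Poly_Mapping.lookup (shift a f) (p n)"
      by (simp add: p_def lookup_shift frag_cmul_distrib diff_diff_eq add.commute)
    then show ?case using Suc assms(1) by (simp add: in_keys_iff)
  qed
  moreover have "inj p"
  proof (rule injI)
    fix m n assume "p m = p n"
    then have "frag_cmul (int m) a = frag_cmul (int n) a"
      by (simp add: p_def del: minus_frag_cmul)
    then have "Poly_Mapping.lookup (frag_cmul (int m) a) i = Poly_Mapping.lookup (frag_cmul (int n) a) i"
      by simp
    then show "m = n" using i by simp
  qed
  ultimately have "infinite (Poly_Mapping.keys f)"
    by (meson image_subsetI infinite_super range_inj_infinite)
  then show False by simp
qed

text \<open>The semidirect product of the edge chains with the vectors acting by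
  \<open>shift\<close>. Multiplication concatenates paths: the second one starts where the first one
  ends.\<close>

definition magnus_group :: "((nat \<times> (nat \<Rightarrow>\<^sub>0 int) \<Rightarrow>\<^sub>0 int) \<times> (nat \<Rightarrow>\<^sub>0 int)) monoid" where
  "magnus_group =
     \<lparr>carrier = UNIV, monoid.mult = (\<lambda>u v. (fst u + shift (snd u) (fst v), snd u + snd v)), one = (0, 0)\<rparr>"

definition magnus_gen :: "nat \<Rightarrow> (nat \<times> (nat \<Rightarrow>\<^sub>0 int) \<Rightarrow>\<^sub>0 int) \<times> (nat \<Rightarrow>\<^sub>0 int)" where
  "magnus_gen i = (frag_of (i, 0), frag_of i)"

lemma magnus_simps [simp]:
  "carrier magnus_group = UNIV"
  "\<one>\<^bsub>magnus_group\<^esub> = (0, 0)"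
  "u \<otimes>\<^bsub>magnus_group\<^esub> v = (fst u + shift (snd u) (fst v), snd u + snd v)"
  by (simp_all add: magnus_group_def)

lemma group_magnus_group: "group magnus_group"
proof (rule groupI)
  show "\<exists>v\<in>carrier magnus_group. v \<otimes>\<^bsub>magnus_group\<^esub> u = \<one>\<^bsub>magnus_group\<^esub>" for u
    by (intro bexI[of _ "(- shift (- snd u) (fst u), - snd u)"]) auto
qed (simp_all add: shift_add shift_shift add.assoc)

interpretation magnus: group magnus_group
  by (rule group_magnus_group)

lemma inv_magnus: "inv\<^bsub>magnus_group\<^esub> u = (- shift (- snd u) (fst u), - snd u)"
  by (rule magnus.inv_equality) auto

lemma conj_magnus:
  "snd v = 0 \<Longrightarrow> u \<otimes>\<^bsub>magnus_group\<^esub> v \<otimes>\<^bsub>magnus_group\<^esub> inv\<^bsub>magnus_group\<^esub> u = (shift (snd u) (fst v), 0)"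
  by (simp add: inv_magnus shift_minus shift_shift)

lemma pow_magnus:
  "snd v = 0 \<Longrightarrow> v [^]\<^bsub>magnus_group\<^esub> (n::nat) = (frag_cmul (int n) (fst v), 0)"
  by (induction n) (simp_all add: frag_cmul_distrib add.commute)

lemma snd_nat_pow_magnus: "snd (v [^]\<^bsub>magnus_group\<^esub> (n::nat)) = frag_cmul (int n) (snd v)"
  by (induction n) (simp_all add: frag_cmul_distrib add.commute)

lemma snd_int_pow_magnus: "snd (v [^]\<^bsub>magnus_group\<^esub> (n::int)) = frag_cmul n (snd v)"
  by (cases n rule: int_cases2)
    (simp_all add: int_pow_int magnus.int_pow_neg_int inv_magnus snd_nat_pow_magnus)

section \<open>Derived subgroups under maps to the Magnus group\<close>

lemma (in group) derived_subset:
  assumes "subgroup N G" "\<And>x y. \<lbrakk>x \<in> H; y \<in> H\<rbrakk> \<Longrightarrow> x \<otimes> y \<otimes> inv x \<otimes> inv y \<in> N"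
  shows "derived G H \<subseteq> N"
  unfolding derived_def using assms by (intro generate_subgroup_incl) auto

text \<open>This is the \<open>M\<close> to which \<open>exists_moved_point\<close> is applied; by
  \<open>derived_subset_magnus_kernel\<close> it contains the derived subgroup.\<close>

definition magnus_kernel where
  "magnus_kernel G h = {g \<in> carrier G. snd (h g) = (0 :: nat \<Rightarrow>\<^sub>0 int)}"

lemma normal_magnus_kernel:
  assumes "group G" "h \<in> hom G magnus_group"
  shows "magnus_kernel G h \<lhd> G"
proof -
  interpret group_hom G magnus_group h
    using assms by (simp add: group_hom_def group_hom_axioms_def group_magnus_group)
  have "subgroup (magnus_kernel G h) G"
    by (rule G.subgroupI) (auto simp: magnus_kernel_def inv_magnus intro!: exI[of _ "\<one>\<^bsub>G\<^esub>"])
  then show ?thesis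
    by (auto simp: G.normal_inv_iff magnus_kernel_def inv_magnus)
qed

lemma derived_subset_magnus_kernel:
  assumes "group G" "h \<in> hom G magnus_group"
  shows "derived G (carrier G) \<subseteq> magnus_kernel G h"
proof -
  interpret group_hom G magnus_group h
    using assms by (simp add: group_hom_def group_hom_axioms_def group_magnus_group)
  show ?thesis
    using normal_imp_subgroup[OF normal_magnus_kernel[OF assms]]
    by (rule G.derived_subset) (auto simp: magnus_kernel_def inv_magnus)
qed

text \<open>The derived subgroup lands in the pure edge chains, which commute. Hence a map from the
  free group descends to its free metabelian quotient.\<close>

lemma second_derived_subset_kernel:
  assumes "group G" "h \<in> hom G magnus_group"
  shows "derived G (derived G (carrier G)) \<subseteq> kernel G magnus_group h"
proof -
  interpret group_hom G magnus_group h
    using assms by (simp add: group_hom_def group_hom_axioms_def group_magnus_group)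
  show ?thesis
    using subgroup_kernel
  proof (rule G.derived_subset)
    fix x y assume "x \<in> derived G (carrier G)" "y \<in> derived G (carrier G)"
    then have "x \<in> carrier G" "y \<in> carrier G" "snd (h x) = 0" "snd (h y) = 0"
      using derived_subset_magnus_kernel[OF assms] by (auto simp: magnus_kernel_def)
    then show "x \<otimes>\<^bsub>G\<^esub> y \<otimes>\<^bsub>G\<^esub> inv\<^bsub>G\<^esub> x \<otimes>\<^bsub>G\<^esub> inv\<^bsub>G\<^esub> y \<in> kernel G magnus_group h"
      by (auto simp: kernel_def inv_magnus)
  qed
qed

text \<open>Injectivity pulls the properties of chains back to \<open>G\<close>: they form a
  torsion-free abelian group, and a nonzero translation fixes only the zero chain.\<close>

lemma metabelian_tf_magnus:
  assumes G: "group G" and h: "h \<in> hom G magnus_group" and inj: "inj_on h (carrier G)"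
  shows "metabelian_tf (magnus_kernel G h) G"
proof -
  interpret group_hom G magnus_group h
    using assms by (simp add: group_hom_def group_hom_axioms_def group_magnus_group)
  have eqI: "u = v" if "h u = h v" "u \<in> carrier G" "v \<in> carrier G" for u v
    using inj that by (rule inj_onD)
  show ?thesis
  proof (intro metabelian_tf.intro metabelian_tf_axioms.intro normal_magnus_kernel[OF G h])
    fix u v assume "u \<in> magnus_kernel G h" "v \<in> magnus_kernel G h"
    then have uv: "u \<in> carrier G" "v \<in> carrier G" "snd (h u) = 0" "snd (h v) = 0"
      by (auto simp: magnus_kernel_def)
    then have "h (u \<otimes>\<^bsub>G\<^esub> v) = h (v \<otimes>\<^bsub>G\<^esub> u)"
      by (simp add: add.commute)
    then show "u \<otimes>\<^bsub>G\<^esub> v = v \<otimes>\<^bsub>G\<^esub> u"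
      using uv by (intro eqI) auto
  next
    fix g k assume "g \<in> carrier G" "k \<in> carrier G"
    then show "g \<otimes>\<^bsub>G\<^esub> k \<otimes>\<^bsub>G\<^esub> inv\<^bsub>G\<^esub> g \<otimes>\<^bsub>G\<^esub> inv\<^bsub>G\<^esub> k \<in> magnus_kernel G h"
      by (simp add: magnus_kernel_def inv_magnus)
  next
    fix u and n :: nat
    assume u: "u \<in> magnus_kernel G h" "u [^]\<^bsub>G\<^esub> n = \<one>\<^bsub>G\<^esub>" "0 < n"
    then have "h u [^]\<^bsub>magnus_group\<^esub> n = (0, 0)"
      using hom_nat_pow[of u n] by (simp add: magnus_kernel_def)
    then have "h u = (0, 0)"
      using u pow_magnus[of "h u" n] by (simp add: magnus_kernel_def prod_eq_iff)
    then show "u = \<one>\<^bsub>G\<^esub>" using u by (intro eqI) (auto simp: magnus_kernel_def)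
  next
    fix g u
    assume g: "g \<in> carrier G" "g \<notin> magnus_kernel G h" "u \<in> magnus_kernel G h"
      "g \<otimes>\<^bsub>G\<^esub> u \<otimes>\<^bsub>G\<^esub> inv\<^bsub>G\<^esub> g = u"
    then have u: "u \<in> carrier G" "snd (h u) = 0" by (auto simp: magnus_kernel_def)
    have "h (g \<otimes>\<^bsub>G\<^esub> u \<otimes>\<^bsub>G\<^esub> inv\<^bsub>G\<^esub> g) = (shift (snd (h g)) (fst (h u)), 0)"
      using g(1) u conj_magnus[of "h u" "h g"] by (simp del: magnus_simps)
    then have "shift (snd (h g)) (fst (h u)) = fst (h u)"
      unfolding g(4) by (metis fst_conv)
    then have "fst (h u) = 0"
      using g shift_invariant_imp_zero[of "snd (h g)" "fst (h u)"]
      by (auto simp: magnus_kernel_def)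
    then show "u = \<one>\<^bsub>G\<^esub>" using u by (intro eqI) (auto simp: prod_eq_iff)
  qed
qed

text \<open>
  With a section \<open>s\<close> of the abelianization, \<open>\<gamma>\<close> is the Reidemeister--Schreier generator attached
  to an edge. Since \<open>\<gamma>\<close> takes values in an abelian group, \<open>\<rho>\<close> reconstructs an element from its
  edge counts, up to the constant factor \<open>\<rho> \<one>\<close>.
\<close>

lemma magnus_embedding:
  fixes G (structure)
  assumes G: "group G"
    and x: "x \<in> I \<rightarrow> carrier G" and gen: "generate G (x ` I) = carrier G"
    and metab: "derived G (derived G (carrier G)) = {\<one>}"
    and h: "h \<in> hom G magnus_group" and hx: "\<And>i. i \<in> I \<Longrightarrow> h (x i) = magnus_gen i"
  shows "inj_on h (carrier G)"
proof -
  interpret group_hom G magnus_group h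
    using G h by (simp add: group_hom_def group_hom_axioms_def group_magnus_group)
  define D where "D = derived G (carrier G)"
  interpret D: normal D G
    unfolding D_def by (rule G.derived_self_is_normal)
  interpret A: comm_group "G Mod D"
    unfolding D_def by (rule G.derived_quot_is_comm_group)
  have DD: "u \<otimes> v = v \<otimes> u" if "u \<in> D" "v \<in> D" for u v
  proof -
    have "u \<otimes> v \<otimes> inv u \<otimes> inv v \<in> derived G D"
      unfolding derived_def using that by (intro generate.incl) auto
    then have "u \<otimes> v \<otimes> inv u \<otimes> inv v = \<one>"
      using metab by (simp add: D_def)
    then have "u \<otimes> v \<otimes> inv (v \<otimes> u) = \<one>"
      using that by (simp add: G.inv_mult_group G.m_assoc)
    then show ?thesis
      using that G.inv_solve_right'[of "\<one>" "u \<otimes> v" "v \<otimes> u"] by simp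
  qed
  interpret DG: comm_group "G\<lparr>carrier := D\<rparr>"
    using D.subgroup_is_group[OF G] by (rule group.group_comm_groupI) (simp add: DD)
  \<comment> \<open>Chains may use directions outside \<open>I\<close>; giving these the trivial
    element makes \<open>\<gamma>\<close> total.\<close>
  define Y where "Y i = (if i \<in> I then x i else \<one>)" for i
  have Y: "Y i \<in> carrier G" for i
    using x by (auto simp: Y_def)
  obtain \<sigma> where \<sigma>: "\<sigma> \<in> hom (free_Abelian_group UNIV) (G Mod D)"
    "\<And>i. \<sigma> (frag_of i) = D #> Y i"
    by (rule A.free_Abelian_group_universal[of "\<lambda>i. D #> Y i" UNIV]) (use Y in \<open>auto simp: carrier_FactGroup\<close>)
  have "\<exists>g\<in>carrier G. D #> g = \<sigma> a" for a
    using Group.hom_in_carrier[OF \<sigma>(1), of a] by (auto simp: carrier_FactGroup)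
  then obtain s where s: "\<And>a. s a \<in> carrier G" "\<And>a. D #> s a = \<sigma> a"
    by metis
  define \<gamma> where "\<gamma> = (\<lambda>(i, a). s a \<otimes> Y i \<otimes> inv (s (a + frag_of i)))"
  \<comment> \<open>\<open>s a \<otimes> Y i\<close> and \<open>s (a + frag_of i)\<close> lie in the
    same coset of \<open>D\<close>, since both map to
    \<open>\<sigma> (a + frag_of i)\<close>.\<close>
  have \<gamma>: "\<gamma> e \<in> D" for e
  proof -
    obtain i a where e: "e = (i, a)" by force
    have "D #> (s a \<otimes> Y i) = \<sigma> a <#> \<sigma> (frag_of i)"
      using s Y \<sigma>(2) D.rcos_sum[of "s a" "Y i"] by simp
    also have "\<dots> = D #> s (a + frag_of i)"
      using Group.hom_mult[OF \<sigma>(1), of a "frag_of i"] s by simp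
    finally show ?thesis
      using s Y G.rcos_self[of "s a \<otimes> Y i" D] D.subgroup_axioms 
        subgroup.rcos_module_imp[OF D.subgroup_axioms G, of "s (a + frag_of i)" "s a \<otimes> Y i"]
      by (simp add: e \<gamma>_def)
  qed
  obtain \<Gamma> where \<Gamma>: "\<Gamma> \<in> hom (free_Abelian_group UNIV) (G\<lparr>carrier := D\<rparr>)"
    "\<And>e. \<Gamma> (frag_of e) = \<gamma> e"
    by (rule DG.free_Abelian_group_universal[of \<gamma> UNIV]) (use \<gamma> in auto)
  have \<Gamma>D: "\<Gamma> f \<in> carrier G" for f
    using Group.hom_in_carrier[OF \<Gamma>(1), of f] by simp
  define \<rho> where "\<rho> u = \<Gamma> (fst u) \<otimes> s (snd u)" for u
  have \<rho>: "\<rho> u \<in> carrier G" for u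
    using \<Gamma>D s by (simp add: \<rho>_def)
  \<comment> \<open>Appending \<open>x i\<close> adds the edge that starts at \<open>snd u\<close>
    in direction \<open>i\<close>; the inverse at the end of its \<open>\<gamma>\<close> cancels the
    new value of the section.\<close>
  have step: "\<rho> (u \<otimes>\<^bsub>magnus_group\<^esub> h (x i)) = \<rho> u \<otimes> x i" if i: "i \<in> I" for u i
  proof -
    have "\<rho> (u \<otimes>\<^bsub>magnus_group\<^esub> h (x i)) = \<Gamma> (fst u) \<otimes> \<gamma> (i, snd u) \<otimes> s (snd u + frag_of i)"
      using Group.hom_mult[OF \<Gamma>(1), of "fst u" "frag_of (i, snd u)"] i
      by (simp add: hx magnus_gen_def \<rho>_def \<Gamma>(2))
    also have "\<dots> = \<rho> u \<otimes> x i"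
      using s Y[of i] \<Gamma>D i by (simp add: \<gamma>_def \<rho>_def Y_def G.m_assoc)
    finally show ?thesis .
  qed
  have XI: "x ` I \<subseteq> carrier G" using x by auto
  have "\<forall>u. \<rho> (u \<otimes>\<^bsub>magnus_group\<^esub> h g) = \<rho> u \<otimes> g" if "g \<in> generate G (x ` I)" for g
    using that
  proof (induction rule: generate.induct)
    case one
    then show ?case using \<rho> by simp
  next
    case (incl g)
    then show ?case using step by auto
  next
    case (inv g)
    then have g: "g \<in> carrier G" using XI by auto
    \<comment> \<open>For an inverse, the generator step is applied at the point already reached by
      \<open>h (inv g)\<close> and then solved for its value there.\<close>
    have "\<rho> u = \<rho> (u \<otimes>\<^bsub>magnus_group\<^esub> h (inv g)) \<otimes> g" for u
    proof -
      have "u = u \<otimes>\<^bsub>magnus_group\<^esub> h (inv g) \<otimes>\<^bsub>magnus_group\<^esub> h g"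
        using g by (simp del: magnus_simps(3) add: magnus.m_assoc)
      then show ?thesis using step inv by (metis imageE)
    qed
    then show ?case using g \<rho> by (metis G.inv_solve_right)
  next
    case (eng g k)
    then have gk: "g \<in> carrier G" "k \<in> carrier G" using gen by auto
    show ?case
    proof
      fix u
      have "u \<otimes>\<^bsub>magnus_group\<^esub> h (g \<otimes> k) = u \<otimes>\<^bsub>magnus_group\<^esub> h g \<otimes>\<^bsub>magnus_group\<^esub> h k"
        using gk magnus.m_assoc[of u "h g" "h k"] by (simp del: magnus_simps(3))
      then have "\<rho> (u \<otimes>\<^bsub>magnus_group\<^esub> h (g \<otimes> k)) = \<rho> u \<otimes> g \<otimes> k"
        using eng.IH by (simp only:)
      then show "\<rho> (u \<otimes>\<^bsub>magnus_group\<^esub> h (g \<otimes> k)) = \<rho> u \<otimes> (g \<otimes> k)"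
        using gk \<rho> by (simp only: G.m_assoc)
    qed
  qed
  \<comment> \<open>Starting from the identity, \<open>\<rho> (h g)\<close> is \<open>g\<close> up
    to a fixed left factor, so \<open>h g\<close> determines \<open>g\<close>.\<close>
  then have "\<rho> (\<one>\<^bsub>magnus_group\<^esub> \<otimes>\<^bsub>magnus_group\<^esub> h g) = \<rho> \<one>\<^bsub>magnus_group\<^esub> \<otimes> g" if "g \<in> carrier G" for g
    using that gen by blast
  then show ?thesis
    using \<rho> by (intro inj_onI) (metis G.l_cancel)
qed

lemma free_metabelian_group_magnus:
  shows "free_metabelian_gen d \<in> {1..d} \<rightarrow> carrier (free_metabelian_group d)"
    and "generate (free_metabelian_group d) (free_metabelian_gen d ` {1..d}) = carrier (free_metabelian_group d)"
    and "derived (free_metabelian_group d) (derived (free_metabelian_group d) (carrier (free_metabelian_group d))) =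
      {\<one>\<^bsub>free_metabelian_group d\<^esub>}"
    and "\<exists>h\<in>hom (free_metabelian_group d) magnus_group. inj_on h (carrier (free_metabelian_group d)) \<and>
           (\<forall>i\<in>{1..d}. h (free_metabelian_gen d i) = magnus_gen i)"
proof -
  define F where "F = free_group {1..d}"
  define N where "N = derived F (derived F (carrier F))"
  let ?G = "free_metabelian_group d"
  let ?gens = "free_metabelian_gen d"
  have F: "group F" unfolding F_def by (rule group_free_group)
  have G: "?G = F Mod N"
    by (simp add: free_metabelian_group_def F_def N_def Let_def)
  have N: "N \<lhd> F"
    unfolding N_def by (rule second_derived_normal[OF F])
  interpret G: group ?G by (rule group_free_metabelian_group)
  interpret \<pi>: group_hom F ?G "\<lambda>x. N #>\<^bsub>F\<^esub> x"
    unfolding group_hom_def group_hom_axioms_def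
    using normal.r_coset_hom_Mod[OF N] G F G.is_group by simp
  have X_def: "?gens i = N #>\<^bsub>F\<^esub> free_gen i" for i
    by (simp add: free_metabelian_gen_def F_def N_def Let_def)
  have gF: "free_gen i \<in> carrier F" if "i \<in> {1..d}" for i
    using that unfolding F_def by (rule free_gen_in_carrier)
  then show gens: "?gens \<in> {1..d} \<rightarrow> carrier ?G"
    using \<pi>.hom_closed by (auto simp: X_def)
  have car: "carrier ?G = (\<lambda>x. N #>\<^bsub>F\<^esub> x) ` carrier F"
    by (simp add: G carrier_FactGroup)
  have "?gens ` {1..d} = (\<lambda>x. N #>\<^bsub>F\<^esub> x) ` (free_gen ` {1..d})"
    by (simp add: X_def image_image)
  then show gen: "generate ?G (?gens ` {1..d}) = carrier ?G"
    using \<pi>.generate_img[of "free_gen ` {1..d}"] gF generate_free_group[of "{1..d}"] car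
    by (metis (no_types, lifting) F_def image_subsetI)
  \<comment> \<open>Surjections send derived subgroups onto derived subgroups, so the second one is
    the image of \<open>N\<close> itself.\<close>
  have "derived ?G (derived ?G (carrier ?G)) = (\<lambda>x. N #>\<^bsub>F\<^esub> x) ` N"
    using \<pi>.derived_img[of "carrier F"] \<pi>.derived_img[of "derived F (carrier F)"]
      group.derived_in_carrier[OF F] by (simp add: car N_def)
  also have "\<dots> = {\<one>\<^bsub>?G\<^esub>}"
  proof -
    have "N #>\<^bsub>F\<^esub> x = N" if "x \<in> N" for x
      using that N by (meson group.coset_join2 F normal_imp_subgroup subgroup.mem_carrier)
    then show ?thesis
      using subgroup.one_closed[OF normal_imp_subgroup[OF N]] by (auto simp: G)
  qed
  finally show metab: "derived ?G (derived ?G (carrier ?G)) = {\<one>\<^bsub>?G\<^esub>}" .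
  \<comment> \<open>By freeness the map exists on \<open>F\<close>; it kills \<open>N\<close> and
    therefore descends to the quotient.\<close>
  obtain h0 where h0: "h0 \<in> hom F magnus_group" "\<And>i. i \<in> {1..d} \<Longrightarrow> h0 (free_gen i) = magnus_gen i"
    using free_group_universal[OF group_magnus_group, of magnus_gen "{1..d}"] by (auto simp: F_def)
  have "group_hom F magnus_group h0"
    using F h0 by (simp add: group_hom_def group_hom_axioms_def group_magnus_group)
  then obtain h where h: "h \<in> hom ?G magnus_group" "\<And>x. x \<in> carrier F \<Longrightarrow> h (N #>\<^bsub>F\<^esub> x) = h0 x"
    using group_hom.FactGroup_universal_kernel[of F magnus_group h0 N] N
      second_derived_subset_kernel[OF F h0(1)] by (metis G N_def)
  have hX: "h (?gens i) = magnus_gen i" if "i \<in> {1..d}" for i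
    using that h h0 gF by (simp add: X_def)
  have "inj_on h (carrier ?G)"
    by (rule magnus_embedding[OF G.is_group gens gen metab h(1) hX])
  then show "\<exists>h\<in>hom ?G magnus_group. inj_on h (carrier ?G) \<and> (\<forall>i\<in>{1..d}. h (?gens i) = magnus_gen i)"
    using h hX by blast
qed

section \<open>Growth of actions and non-foldable tuples\<close>

text \<open>Described by words rather than by \<open>word_length\<close>, so that products become
  concatenations; \<open>word_length_ball\<close> identifies the two.\<close>

definition word_ball :: "('g, 'm) monoid_scheme \<Rightarrow> 'g set \<Rightarrow> nat \<Rightarrow> 'g set" where
  "word_ball G S r =
     {foldr (\<lambda>s x. s \<otimes>\<^bsub>G\<^esub> x) w \<one>\<^bsub>G\<^esub> | w. set w \<subseteq> S \<and> length w \<le> r}"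

lemma word_ball_mono: "r \<le> s \<Longrightarrow> word_ball G S r \<subseteq> word_ball G S s"
  unfolding word_ball_def using le_trans by blast

lemma finite_word_ball: "finite S \<Longrightarrow> finite (word_ball G S r)"
proof -
  assume "finite S"
  then have "finite {w. set w \<subseteq> S \<and> length w \<le> r}"
    by (rule finite_lists_length_le)
  then show ?thesis
    unfolding word_ball_def by (simp add: setcompr_eq_image)
qed

context group
begin

lemma word_product_closed:
  "set w \<subseteq> carrier G \<Longrightarrow> foldr (\<lambda>s x. s \<otimes> x) w \<one> \<in> carrier G"
  by (induction w) auto

lemma word_ball_subset: "S \<subseteq> carrier G \<Longrightarrow> word_ball G S r \<subseteq> carrier G"
  unfolding word_ball_def using word_product_closed by blast

lemma word_ball_mult:
  assumes S: "S \<subseteq> carrier G" and g: "g \<in> word_ball G S r" and h: "h \<in> word_ball G S s"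
  shows "g \<otimes> h \<in> word_ball G S (r + s)"
proof -
  obtain v where v: "set v \<subseteq> S" "length v \<le> r" "g = foldr (\<lambda>s x. s \<otimes> x) v \<one>"
    using g by (auto simp: word_ball_def)
  obtain w where w: "set w \<subseteq> S" "length w \<le> s" "h = foldr (\<lambda>s x. s \<otimes> x) w \<one>"
    using h by (auto simp: word_ball_def)
  have hG: "h \<in> carrier G" using word_ball_subset[OF S] h by auto
  have "set v \<subseteq> S \<Longrightarrow> foldr (\<lambda>s x. s \<otimes> x) v \<one> \<otimes> h = foldr (\<lambda>s x. s \<otimes> x) v h" for v
  proof (induction v)
    case (Cons s v)
    then have "s \<in> carrier G" "foldr (\<lambda>s x. s \<otimes> x) v \<one> \<in> carrier G"
      using S word_product_closed[of v] by auto
    then show ?case using Cons hG by (simp add: m_assoc)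
  qed (use hG in simp)
  then have "g \<otimes> h = foldr (\<lambda>s x. s \<otimes> x) (v @ w) \<one>"
    using v w by simp
  then show ?thesis
    using v w unfolding word_ball_def by (intro CollectI exI[of _ "v @ w"]) auto
qed

lemma one_in_word_ball: "\<one> \<in> word_ball G S r"
  unfolding word_ball_def by (auto intro!: exI[of _ "[]"])

lemma generator_in_word_ball: "\<lbrakk>S \<subseteq> carrier G; s \<in> S\<rbrakk> \<Longrightarrow> s \<in> word_ball G S 1"
  unfolding word_ball_def by (auto intro!: exI[of _ "[s]"])

end

section \<open>The word metric of a symmetric generating set\<close>

locale sym_gen_group = group +
  fixes S
  assumes sym_gen: "finite_symmetric_generating_set G S"
begin

lemma S_subset: "S \<subseteq> carrier G" and fin_S: "finite S" and inv_S: "s \<in> S \<Longrightarrow> inv s \<in> S"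
  and gen_S: "generate G S = carrier G"
  using sym_gen by (auto simp: finite_symmetric_generating_set_def)

abbreviation "ball \<equiv> word_ball G S"

lemma ball_carrier: "g \<in> ball r \<Longrightarrow> g \<in> carrier G"
  using word_ball_subset[OF S_subset] by blast

lemma ball_inv: "g \<in> ball r \<Longrightarrow> inv g \<in> ball r"
proof -
  assume "g \<in> ball r"
  then obtain w where w: "set w \<subseteq> S" "length w \<le> r" "g = foldr (\<lambda>s x. s \<otimes> x) w \<one>"
    by (auto simp: word_ball_def)
  have "set w \<subseteq> S \<Longrightarrow> inv (foldr (\<lambda>s x. s \<otimes> x) w \<one>) \<in> ball (length w)" for w
  proof (induction w)
    case Nil
    then show ?case using one_in_word_ball by simp
  next
    case (Cons s w)
    then have "foldr (\<lambda>s x. s \<otimes> x) w \<one> \<in> carrier G" "s \<in> carrier G"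
      using S_subset by (auto intro!: word_product_closed)
    moreover have "inv (foldr (\<lambda>s x. s \<otimes> x) w \<one>) \<otimes> inv s \<in> ball (length w + 1)"
      using Cons inv_S by (intro word_ball_mult S_subset generator_in_word_ball) auto
    ultimately show ?case by (simp add: inv_mult_group)
  qed
  from this[OF w(1)] show ?thesis
    using subsetD[OF word_ball_mono[OF w(2)]] w(3) by simp
qed

lemma ball_nat_pow: "g \<in> ball r \<Longrightarrow> g [^] (n::nat) \<in> ball (n * r)"
proof (induction n)
  case (Suc n)
  then show ?case
    using word_ball_mult[OF S_subset, of "g [^] n" "n * r" g r] by (simp add: add.commute)
qed (simp add: one_in_word_ball)

lemma ball_int_pow:
  assumes "g \<in> ball r" "\<bar>k\<bar> \<le> int n"
  shows "g [^] k \<in> ball (n * r)"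
proof -
  have "g [^] k \<in> ball (nat \<bar>k\<bar> * r)"
    using ball_nat_pow[OF assms(1)] ball_inv ball_carrier[OF assms(1)]
    by (cases k rule: int_cases2) (auto simp: int_pow_int int_pow_neg_int)
  moreover have "nat \<bar>k\<bar> * r \<le> n * r" using assms(2) by (intro mult_right_mono) auto
  ultimately show ?thesis by (meson subsetD word_ball_mono)
qed

lemma in_ball_ex: "g \<in> carrier G \<Longrightarrow> \<exists>r. g \<in> ball r"
proof -
  assume "g \<in> carrier G"
  then have "g \<in> generate G S" by (simp add: gen_S)
  then show ?thesis
  proof (induction rule: generate.induct)
    case one
    then show ?case using one_in_word_ball by blast
  next
    case (incl s)
    then show ?case using generator_in_word_ball[OF S_subset] by blast
  next
    case (inv s)
    then show ?case using generator_in_word_ball[OF S_subset] ball_inv by blast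
  next
    case (eng g h)
    then show ?case using word_ball_mult[OF S_subset] by blast
  qed
qed

lemma word_length_ball: "{g \<in> carrier G. word_length G S g \<le> n} = ball n"
proof (intro equalityI subsetI)
  fix g assume g: "g \<in> {g \<in> carrier G. word_length G S g \<le> n}"
  let ?P = "\<lambda>n. \<exists>w. set w \<subseteq> S \<and> length w = n \<and> foldr (\<lambda>s x. s \<otimes> x) w \<one> = g"
  have "\<exists>n. ?P n" using in_ball_ex[of g] g by (auto simp: word_ball_def)
  then have "?P (word_length G S g)"
    unfolding word_length_def by (rule LeastI_ex)
  then show "g \<in> ball n" using g by (auto simp: word_ball_def)
next
  fix g assume g: "g \<in> ball n"
  then obtain w where w: "set w \<subseteq> S" "length w \<le> n" "foldr (\<lambda>s x. s \<otimes> x) w \<one> = g"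
    by (auto simp: word_ball_def)
  then have "word_length G S g \<le> length w"
    unfolding word_length_def by (intro Least_le) blast
  then show "g \<in> {g \<in> carrier G. word_length G S g \<le> n}"
    using w g ball_carrier by auto
qed

lemma vol_eq: "vol G S E \<phi> n = Max ((\<lambda>x. card ((\<lambda>g. \<phi> g x) ` ball n)) ` E)"
  by (simp add: vol_def word_length_ball)

text \<open>\<open>E\<close> may be infinite, but each orbit piece has at most as many points as the
  ball, so the maximum is over a finite set of numbers.\<close>

lemma finite_vol_set: "finite ((\<lambda>x. card ((\<lambda>g. \<phi> g x) ` ball n)) ` E)"
  by (rule finite_subset[of _ "{..card (ball n)}"])
    (auto intro!: card_image_le finite_word_ball fin_S)

lemma vol_ge: "x \<in> E \<Longrightarrow> card ((\<lambda>g. \<phi> g x) ` ball n) \<le> vol G S E \<phi> n"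
  unfolding vol_eq by (intro Max_ge finite_vol_set) auto

lemma vol_le:
  assumes "E \<noteq> {}" "\<And>x. x \<in> E \<Longrightarrow> card ((\<lambda>g. \<phi> g x) ` ball n) \<le> K"
  shows "vol G S E \<phi> n \<le> K"
  unfolding vol_eq using assms by (intro Max.boundedI finite_vol_set) auto

end

text \<open>The group element behind \<open>tuple_act\<close>: powers are multiplied on the left, so
  the first entry acts first. The start value \<open>y\<close> serves as accumulator in
  inductions.\<close>

definition tuple_elt :: "('g, 'm) monoid_scheme \<Rightarrow> 'g list \<Rightarrow> int list \<Rightarrow> 'g \<Rightarrow> 'g" where
  "tuple_elt G gs ns = fold (\<lambda>(g, n) y. g [^]\<^bsub>G\<^esub> n \<otimes>\<^bsub>G\<^esub> y) (zip gs ns)"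

lemma tuple_elt_simps [simp]:
  "tuple_elt G (g # gs) (n # ns) y = tuple_elt G gs ns (g [^]\<^bsub>G\<^esub> n \<otimes>\<^bsub>G\<^esub> y)"
  "tuple_elt G [] ns y = y"
  "tuple_elt G gs [] y = y"
  by (simp_all add: tuple_elt_def)

lemma (in group) tuple_elt_closed:
  "\<lbrakk>set gs \<subseteq> carrier G; y \<in> carrier G\<rbrakk> \<Longrightarrow> tuple_elt G gs ns y \<in> carrier G"
proof (induction gs arbitrary: ns y)
  case (Cons g gs)
  then show ?case by (cases ns) auto
qed simp

lemma (in group) tuple_elt_mult:
  "\<lbrakk>set gs \<subseteq> carrier G; y \<in> carrier G\<rbrakk> \<Longrightarrow> tuple_elt G gs ns y = tuple_elt G gs ns \<one> \<otimes> y"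
proof (induction gs arbitrary: ns y)
  case (Cons g gs)
  show ?case
  proof (cases ns)
    case Nil
    then show ?thesis using Cons by simp
  next
    case (Cons n ns')
    have g: "g [^] n \<in> carrier G" "set gs \<subseteq> carrier G" using Cons.prems by auto
    show ?thesis
      using Cons.IH[of "g [^] n \<otimes> y" ns'] Cons.IH[of "g [^] n" ns'] Cons.prems g
        tuple_elt_closed[of gs "\<one>" ns'] by (simp add: Cons m_assoc)
  qed
qed simp

lemma (in group_action) tuple_act_eq:
  "\<lbrakk>set gs \<subseteq> carrier G; y \<in> carrier G; x \<in> E\<rbrakk>
    \<Longrightarrow> tuple_act G \<phi> gs ns (\<phi> y x) = \<phi> (tuple_elt G gs ns y) x"
proof (induction gs arbitrary: ns y)
  case Nil
  then show ?case by (simp add: tuple_act_def)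
next
  case (Cons g gs)
  interpret group G using group_hom by (rule group_hom.axioms(1))
  show ?case
  proof (cases ns)
    case Nil
    then show ?thesis by (simp add: tuple_act_def)
  next
    case (Cons n ns')
    have "tuple_act G \<phi> (g # gs) ns (\<phi> y x) = tuple_act G \<phi> gs ns' (\<phi> (g [^] n) (\<phi> y x))"
      by (simp add: Cons tuple_act_def)
    also have "\<phi> (g [^] n) (\<phi> y x) = \<phi> (g [^] n \<otimes> y) x"
      using Cons.prems by (simp add: composition_rule)
    finally show ?thesis
      using Cons.IH[of "g [^] n \<otimes> y" ns'] Cons.prems by (simp add: Cons)
  qed
qed

lemma (in group_action) tuple_act_eq_one:
  assumes "set gs \<subseteq> carrier G" "x \<in> E"
  shows "tuple_act G \<phi> gs ns x = \<phi> (tuple_elt G gs ns \<one>) x"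
proof -
  interpret group G using group_hom by (rule group_hom.axioms(1))
  show ?thesis
    using tuple_act_eq[OF assms(1) one_closed assms(2), of ns] assms(2)
    by (simp flip: id_eq_one)
qed

lemma (in sym_gen_group) tuple_elt_ball:
  assumes "\<And>g. g \<in> set gs \<Longrightarrow> g \<in> ball c" "set ns \<subseteq> {- int n..int n}" "y \<in> ball r"
  shows "tuple_elt G gs ns y \<in> ball (r + length gs * (n * c))"
  using assms
proof (induction gs arbitrary: ns y r)
  case (Cons g gs)
  show ?case
  proof (cases ns)
    case Nil
    then show ?thesis using Cons.prems word_ball_mono[of r "r + length (g # gs) * (n * c)" G S] by auto
  next
    case (Cons k ns')
    have "g [^] k \<otimes> y \<in> ball (n * c + r)"
      using Cons.prems Cons by (intro word_ball_mult S_subset ball_int_pow) auto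
    then show ?thesis
      using Cons.IH[of ns' "g [^] k \<otimes> y" "n * c + r"] Cons.prems Cons by (simp add: algebra_simps)
  qed
qed simp

lemma card_int_box: "card {ns. length ns = k \<and> set ns \<subseteq> {- int n..int n}} = (2 * n + 1) ^ k"
proof -
  have "{ns. length ns = k \<and> set ns \<subseteq> {- int n..int n}} = {ns. set ns \<subseteq> {- int n..int n} \<and> length ns = k}"
    by blast
  moreover have "card {- int n..int n} = 2 * n + 1" by simp
  ultimately show ?thesis
    using card_lists_length_eq[of "{- int n..int n}" k] by (simp only: finite_atLeastAtMost_int)
qed

lemma finite_int_box: "finite {ns. length ns = k \<and> set ns \<subseteq> {- int n..int n}}"
  by (rule finite_subset[OF _ finite_lists_length_eq[of "{- int n..int n}" k]]) auto

text \<open>A box with \<open>2 * n + 1\<close> values per coordinate injects into one orbit, and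
  its elements have word length at most \<open>length gs * (n * c)\<close>.\<close>

lemma non_foldable_growth_gap:
  fixes G (structure)
  assumes fg: "finitely_generated G" and gs: "set gs \<subseteq> carrier G"
    and nf: "non_foldable TYPE('x) G gs"
  shows "schreier_growth_gap TYPE('x) G (\<lambda>n. real n ^ length gs)"
  unfolding schreier_growth_gap_def
proof (intro conjI allI impI fg)
  fix S and E :: "'x set" and \<phi>
  assume S: "finite_symmetric_generating_set G S" and E: "faithful_G_set G E \<phi>"
  interpret sym_gen_group G S
    using fg S by (simp add: sym_gen_group_def sym_gen_group_axioms_def finitely_generated_def)
  interpret A: faithful_action G E \<phi> using E by (simp add: faithful_G_set_def)
  have "\<exists>c. \<forall>g\<in>set gs. g \<in> ball c"
    using gs
  proof (induction gs)
    case (Cons g gs)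
    then obtain c c' where "\<forall>g\<in>set gs. g \<in> ball c" "g \<in> ball c'"
      using in_ball_ex[of g] by auto
    then show ?case
      using word_ball_mono[of c "max c c'" G S] word_ball_mono[of c' "max c c'" G S]
      by (intro exI[of _ "max c c'"]) auto
  qed simp
  then obtain c where c: "\<And>g. g \<in> set gs \<Longrightarrow> g \<in> ball c" by blast
  \<comment> \<open>The summand 1 keeps \<open>C\<close> positive when the tuple is empty or
    \<open>c = 0\<close>.\<close>
  define C where "C = length gs * c + 1"
  have bound: "n ^ length gs \<le> C * vol G S E \<phi> (C * n)" if n: "1 \<le> n" for n
  proof -
    let ?box = "{ns. length ns = length gs \<and> set ns \<subseteq> {- int n..int n}}"
    obtain x where x: "x \<in> E" "inj_on (\<lambda>ns. tuple_act G \<phi> gs ns x) ?box"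
      using nf E n unfolding non_foldable_def by blast
    have sub: "(\<lambda>ns. tuple_act G \<phi> gs ns x) ` ?box \<subseteq> (\<lambda>g. \<phi> g x) ` ball (C * n)"
    proof (rule image_subsetI)
      fix ns assume "ns \<in> ?box"
      then have "tuple_elt G gs ns \<one> \<in> ball (0 + length gs * (n * c))"
        using c by (intro tuple_elt_ball one_in_word_ball) auto
      moreover have "0 + length gs * (n * c) \<le> C * n"
        by (simp add: C_def algebra_simps)
      ultimately have "tuple_elt G gs ns \<one> \<in> ball (C * n)"
        by (meson subsetD word_ball_mono)
      then show "tuple_act G \<phi> gs ns x \<in> (\<lambda>g. \<phi> g x) ` ball (C * n)"
        using A.tuple_act_eq_one[OF gs x(1)] by simp
    qed
    have "n ^ length gs \<le> (2 * n + 1) ^ length gs" by (intro power_mono) auto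
    also have "\<dots> = card ((\<lambda>ns. tuple_act G \<phi> gs ns x) ` ?box)"
      using x(2) by (simp add: card_image card_int_box)
    also have "\<dots> \<le> card ((\<lambda>g. \<phi> g x) ` ball (C * n))"
      by (intro card_mono sub finite_imageI finite_word_ball fin_S)
    also have "\<dots> \<le> vol G S E \<phi> (C * n)"
      using x(1) by (rule vol_ge)
    also have "\<dots> \<le> C * vol G S E \<phi> (C * n)"
      by (simp add: C_def)
    finally show ?thesis .
  qed
  have "real n ^ length gs \<le> real C * real (vol G S E \<phi> (C * n))" if "1 \<le> n" for n
    using bound[OF that] by (metis of_nat_le_iff of_nat_mult of_nat_power)
  then show "asymp_le (\<lambda>n. real n ^ length gs) (\<lambda>n. real (vol G S E \<phi> n))"
    unfolding asymp_le_def eventually_sequentially by (intro exI[of _ C]) (auto simp: C_def)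
qed

text \<open>Vectors add up, and distinct generators contribute to distinct coordinates. The offset
  \<open>k\<close> and the start \<open>y\<close> make the induction over the tuple
  possible.\<close>

lemma (in group) snd_tuple_elt_magnus:
  assumes h: "h \<in> hom G magnus_group"
    and x: "\<And>i. i \<in> I \<Longrightarrow> x i \<in> carrier G \<and> snd (h (x i)) = frag_of i"
    and "y \<in> carrier G" "{k..<k + length ns} \<subseteq> I"
  shows "Poly_Mapping.lookup (snd (h (tuple_elt G (map x [k..<k + length ns]) ns y))) i =
    Poly_Mapping.lookup (snd (h y)) i + (if k \<le> i \<and> i < k + length ns then ns ! (i - k) else 0)"
  using assms(3,4)
proof (induction ns arbitrary: k y)
  case Nil
  then show ?case by simp
next
  case (Cons n ns)
  interpret H: group_hom G magnus_group h
    using h is_group by (simp add: group_hom_def group_hom_axioms_def group_magnus_group)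
  have k: "k \<in> I" "{Suc k..<Suc k + length ns} \<subseteq> I" using Cons.prems by auto
  have xk: "x k \<in> carrier G" "snd (h (x k)) = frag_of k" using x k by auto
  have "snd (h (x k [^] n \<otimes> y)) = frag_cmul n (frag_of k) + snd (h y)"
    using xk Cons.prems by (simp add: H.hom_int_pow snd_int_pow_magnus)
  moreover have "[k..<k + length (n # ns)] = k # [Suc k..<Suc k + length ns]"
    by (simp add: upt_rec)
  ultimately show ?case
    using Cons.IH[of "x k [^] n \<otimes> y" "Suc k"] Cons.prems xk k
    by (auto simp: lookup_add nth_Cons' Suc_le_eq)
qed

text \<open>The base point is moved by the finitely many quotients of box elements outside the
  kernel and by small powers of \<open>m\<close>. A coincidence gives a quotient fixing it, which
  must lie in the kernel; there the exponents of the generators agree.\<close>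

lemma non_foldable_magnus:
  fixes G (structure)
  assumes G: "group G" and h: "h \<in> hom G magnus_group" and inj: "inj_on h (carrier G)"
    and x: "\<And>i. i \<in> {1..d} \<Longrightarrow> x i \<in> carrier G \<and> snd (h (x i)) = frag_of i"
    and m: "m \<in> magnus_kernel G h" "m \<noteq> \<one>"
  shows "non_foldable TYPE('x) G (m # map x [1..<d + 1])"
  unfolding non_foldable_def
proof (intro allI impI)
  fix E :: "'x set" and \<phi> and n :: nat
  assume E: "faithful_G_set G E \<phi>" and n: "1 \<le> n"
  interpret A: faithful_action G E \<phi> using E by (simp add: faithful_G_set_def)
  interpret H: group_hom G magnus_group h
    using h G by (simp add: group_hom_def group_hom_axioms_def group_magnus_group)
  interpret K: metabelian_tf "magnus_kernel G h" G
    using G h inj by (rule metabelian_tf_magnus)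
  let ?gs = "m # map x [1..<d + 1]"
  let ?box = "{ns. length ns = length ?gs \<and> set ns \<subseteq> {- int n..int n}}"
  define e where "e ns = tuple_elt G ?gs ns \<one>" for ns
  have mG: "m \<in> carrier G" using m by simp
  have xs: "set (map x [1..<d + 1]) \<subseteq> carrier G" using x by auto
  have gs: "set ?gs \<subseteq> carrier G" using xs mG by auto
  have eG: "e ns \<in> carrier G" for ns
    unfolding e_def using gs by (rule H.G.tuple_elt_closed) simp
  define Q where "Q = (\<lambda>(ns, ns'). inv (e ns') \<otimes> e ns) ` (?box \<times> ?box) - magnus_kernel G h"
  have "finite Q" unfolding Q_def using finite_int_box by (intro finite_Diff finite_imageI finite_cartesian_product)
  moreover have "Q \<subseteq> carrier G - magnus_kernel G h"
    using eG by (auto simp: Q_def)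
  \<comment> \<open>Exponents of \<open>m\<close> between \<open>-n\<close> and \<open>n\<close>
    differ by at most \<open>2 * n\<close>.\<close>
  ultimately obtain z where z: "z \<in> E" "\<And>q. q \<in> Q \<Longrightarrow> \<phi> q z \<noteq> z"
    "\<And>k. k \<in> {1..2 * n} \<Longrightarrow> \<phi> (m [^] k) z \<noteq> z"
    using K.exists_moved_point[OF A.faithful_action_axioms _ _ m, of Q "2 * n"] by blast
  have split: "e (k # ns) = tuple_elt G (map x [1..<d + 1]) ns \<one> \<otimes> m [^] k" for k ns
    using H.G.tuple_elt_mult[OF xs, of "m [^] k" ns] mG by (simp add: e_def)
  have "inj_on (\<lambda>ns. tuple_act G \<phi> ?gs ns z) ?box"
  proof (rule inj_onI)
    fix ns ns' assume ns: "ns \<in> ?box" "ns' \<in> ?box"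
      and eq: "tuple_act G \<phi> ?gs ns z = tuple_act G \<phi> ?gs ns' z"
    then have "\<phi> (e ns) z = \<phi> (e ns') z"
      using A.tuple_act_eq_one[OF gs z(1)] by (simp add: e_def)
    then have fixed: "\<phi> (inv (e ns') \<otimes> e ns) z = z"
      using eG z(1) A.orbit_sym_aux[of "e ns'" z] by (simp add: A.composition_rule)
    then have "inv (e ns') \<otimes> e ns \<in> magnus_kernel G h"
      using z(2) ns by (auto simp: Q_def)
    then have "snd (h (inv (e ns') \<otimes> e ns)) = 0"
      unfolding magnus_kernel_def by blast
    then have ab: "snd (h (e ns)) = snd (h (e ns'))"
      using eG by (simp add: inv_magnus)
    obtain k l k' l' where kl: "ns = k # l" "ns' = k' # l'" "length l = d" "length l' = d"
      using ns by (auto simp: length_Suc_conv)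
    \<comment> \<open>\<open>m\<close> has zero vector, so coordinate \<open>i\<close> is read off
      from position \<open>i - 1\<close> of the remaining list.\<close>
    have look: "Poly_Mapping.lookup (snd (h (e (k # l)))) i = l ! (i - 1)"
      if "length l = d" "i \<in> {1..d}" for k l i
    proof -
      have "snd (h (e (k # l))) = snd (h (tuple_elt G (map x [1..<1 + length l]) l \<one>))"
        using mG that(1) xs m(1) 
        by (simp add: split H.G.tuple_elt_closed H.hom_int_pow snd_int_pow_magnus magnus_kernel_def del: K.mem_carrier)
      moreover have "{1..<1 + length l} \<subseteq> {1..d}" using that by auto
      ultimately show ?thesis
        using H.G.snd_tuple_elt_magnus[OF h x H.G.one_closed, of "{1..d}" 1 l i] that by auto
    qed
    have "l = l'"
    proof (rule nth_equalityI)
      fix i assume "i < length l"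
      then show "l ! i = l' ! i"
        using look[of l "Suc i" k] look[of l' "Suc i" k'] kl ab by simp
    qed (use kl in simp)
    \<comment> \<open>As \<open>m\<close> acts first, the common product \<open>p\<close> of the
      other factors cancels in the quotient and leaves a pure power of \<open>m\<close>.\<close>
    define p where "p = tuple_elt G (map x [1..<d + 1]) l \<one>"
    have p: "p \<in> carrier G" unfolding p_def using xs by (rule H.G.tuple_elt_closed) simp
    have "e ns = p \<otimes> m [^] k" "e ns' = p \<otimes> m [^] k'"
      unfolding kl split p_def \<open>l = l'\<close> by (rule refl)+
    then have "inv (e ns') \<otimes> e ns = inv (m [^] k') \<otimes> (inv p \<otimes> (p \<otimes> m [^] k))"
      using p mG by (simp add: H.G.inv_mult_group H.G.m_assoc)
    also have "\<dots> = m [^] (- k') \<otimes> m [^] k"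
      using p mG by (simp add: H.G.m_assoc[symmetric] H.G.int_pow_neg)
    also have "\<dots> = m [^] (k - k')"
      using mG H.G.int_pow_mult[of m "- k'" k] by simp
    finally have fixm: "\<phi> (m [^] (k - k')) z = z" using fixed by simp
    have "k = k'"
    proof (rule ccontr)
      assume "k \<noteq> k'"
      define r where "r = nat \<bar>k - k'\<bar>"
      have "\<phi> (m [^] r) z = z"
      proof (cases "k - k' \<ge> 0")
        case True
        then show ?thesis using fixm by (simp add: r_def flip: int_pow_int)
      next
        case False
        then have "m [^] r = inv (m [^] (k - k'))"
          using mG by (simp add: r_def flip: int_pow_int H.G.int_pow_neg)
        then show ?thesis using fixm A.orbit_sym_aux[of "m [^] (k - k')" z] z mG by simp
      qed
      moreover have "r \<in> {1..2 * n}" using ns \<open>k \<noteq> k'\<close> by (auto simp: r_def kl)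
      ultimately show False using z(3) by blast
    qed
    then show "ns = ns'" using kl \<open>l = l'\<close> by simp
  qed
  then show "\<exists>z\<in>E. inj_on (\<lambda>ns. tuple_act G \<phi> ?gs ns z) ?box"
    using z by blast
qed

section \<open>An action of minimal growth\<close>

text \<open>\<open>j\<close> labels the copy, \<open>k\<close> is the running count and
  \<open>c\<close> the vertex. The coefficient is read at the endpoint \<open>c + snd u\<close>,
  which matches \<open>shift\<close> and yields a left action.\<close>

definition magnus_act ::
    "(nat \<times> (nat \<Rightarrow>\<^sub>0 int) \<Rightarrow>\<^sub>0 int) \<times> (nat \<Rightarrow>\<^sub>0 int) \<Rightarrow> nat \<times> int \<times> (nat \<Rightarrow>\<^sub>0 int) \<Rightarrow> nat \<times> int \<times> (nat \<Rightarrow>\<^sub>0 int)" where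
  "magnus_act u = (\<lambda>(j, k, c). (j, k + Poly_Mapping.lookup (fst u) (j, c + snd u), c + snd u))"

lemma magnus_act_one: "magnus_act (0, 0) p = p"
  by (cases p) (simp add: magnus_act_def)

lemma magnus_act_mult: "magnus_act (u \<otimes>\<^bsub>magnus_group\<^esub> v) p = magnus_act u (magnus_act v p)"
proof (cases p)
  case (fields j k c)
  have "c + (snd u + snd v) - snd u = c + snd v"
    by (metis add.left_commute add_diff_cancel_left')
  then show ?thesis
    by (simp add: fields magnus_act_def lookup_add lookup_shift) (simp add: ac_simps)
qed

text \<open>Varying the starting point \<open>(j, 0, c)\<close> reads off every coefficient of the
  chain, and the last component reads off the vector.\<close>

lemma magnus_act_faithful:
  assumes "\<And>p. magnus_act u p = p"
  shows "u = (0, 0)"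
proof -
  have eq: "Poly_Mapping.lookup (fst u) (j, c + snd u) = 0 \<and> c + snd u = c" for j c
    using assms[of "(j, 0, c)"] by (auto simp: magnus_act_def)
  have "snd u = 0" using eq[of 0 0] by simp
  then have "Poly_Mapping.lookup (fst u) (j, c) = 0" for j c
    using eq[of j c] \<open>snd u = 0\<close> by simp
  then have "fst u = 0"
    by (intro poly_mapping_eqI) auto
  then show ?thesis using \<open>snd u = 0\<close> by (simp add: prod_eq_iff)
qed

section \<open>Transport of the action to the natural numbers\<close>

lemma countable_UNIV_frag: "countable (UNIV :: (nat \<Rightarrow>\<^sub>0 int) set)"
proof -
  define graph where "graph a = (\<lambda>i. (i, Poly_Mapping.lookup a i)) ` Poly_Mapping.keys a"
    for a :: "nat \<Rightarrow>\<^sub>0 int"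
  have "inj graph"
  proof (rule injI)
    fix a b assume eq: "graph a = graph b"
    have mem: "(i, l) \<in> graph a \<longleftrightarrow> l = Poly_Mapping.lookup a i \<and> l \<noteq> 0" for a i l
      by (auto simp: graph_def in_keys_iff)
    show "a = b"
    proof (rule poly_mapping_eqI)
      fix i
      show "Poly_Mapping.lookup a i = Poly_Mapping.lookup b i"
        using mem[of i "Poly_Mapping.lookup a i" a] mem[of i "Poly_Mapping.lookup b i" b]
          mem[of i "Poly_Mapping.lookup a i" b] mem[of i "Poly_Mapping.lookup b i" a] eq by metis
    qed
  qed
  moreover have "range graph \<subseteq> Collect finite"
    by (auto simp: graph_def)
  then have "countable (range graph)"
    by (rule countable_subset) (rule countable_Collect_finite)
  ultimately show ?thesis
    by (rule countable_image_inj_on[rotated])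
qed

lemma exists_point_encoding: "\<exists>enc :: nat \<times> int \<times> (nat \<Rightarrow>\<^sub>0 int) \<Rightarrow> nat. inj enc"
proof -
  have "countable (UNIV \<times> UNIV \<times> UNIV :: (nat \<times> int \<times> (nat \<Rightarrow>\<^sub>0 int)) set)"
    by (intro countable_SIGMA countable_UNIV_frag) auto
  then show ?thesis
    by (auto simp: countable_def)
qed

text \<open>The restriction to \<open>range enc\<close> makes each value extensional, as membership
  in \<open>Bij\<close> requires.\<close>

definition transported_act where
  "transported_act h enc g = (\<lambda>y\<in>range enc. enc (magnus_act (h g) (inv_into UNIV enc y)))"

lemma transported_act_apply:
  "inj enc \<Longrightarrow> transported_act h enc g (enc p) = enc (magnus_act (h g) p)"
  by (simp add: transported_act_def inv_f_f)

lemma faithful_transported_act: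
  assumes G: "group G" and h: "h \<in> hom G magnus_group" and inj: "inj_on h (carrier G)"
    and enc: "inj enc"
  shows "faithful_G_set G (range enc) (transported_act h enc)"
proof -
  interpret H: group_hom G magnus_group h
    using h G by (simp add: group_hom_def group_hom_axioms_def group_magnus_group)
  let ?\<phi> = "transported_act h enc"
  note app = transported_act_apply[OF enc]
  have mult: "?\<phi> (g \<otimes>\<^bsub>G\<^esub> k) (enc p) = ?\<phi> g (?\<phi> k (enc p))" if "g \<in> carrier G" "k \<in> carrier G" for g k p
    using that magnus_act_mult[of "h g" "h k" p] H.hom_mult[OF that] by (simp only: app)
  have one: "?\<phi> \<one>\<^bsub>G\<^esub> (enc p) = enc p" for p
    using H.hom_one by (simp add: app magnus_act_one)
  have ext: "?\<phi> g \<in> extensional (range enc)" for g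
    by (simp add: transported_act_def)
  have Bij: "?\<phi> g \<in> Bij (range enc)" if g: "g \<in> carrier G" for g
  proof -
    have "bij_betw (?\<phi> g) (range enc) (range enc)"
    proof (rule bij_betwI[where g = "?\<phi> (inv\<^bsub>G\<^esub> g)"])
      show "?\<phi> g \<in> range enc \<rightarrow> range enc" "?\<phi> (inv\<^bsub>G\<^esub> g) \<in> range enc \<rightarrow> range enc"
        by (auto simp: app)
      show "?\<phi> (inv\<^bsub>G\<^esub> g) (?\<phi> g y) = y" "?\<phi> g (?\<phi> (inv\<^bsub>G\<^esub> g) y) = y" if "y \<in> range enc" for y
        using that g mult[of "inv\<^bsub>G\<^esub> g" g] mult[of g "inv\<^bsub>G\<^esub> g"] one by auto
    qed
    then show ?thesis using ext by (simp add: Bij_def)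
  qed
  have "?\<phi> \<in> hom G (BijGroup (range enc))"
  proof (rule homI)
    show "?\<phi> g \<in> carrier (BijGroup (range enc))" if "g \<in> carrier G" for g
      using Bij[OF that] by (simp add: BijGroup_def)
    fix g k assume gk: "g \<in> carrier G" "k \<in> carrier G"
    have "?\<phi> (g \<otimes>\<^bsub>G\<^esub> k) = compose (range enc) (?\<phi> g) (?\<phi> k)"
      using mult[OF gk] by (intro extensionalityI[OF ext compose_extensional]) (auto simp: compose_eq)
    then show "?\<phi> (g \<otimes>\<^bsub>G\<^esub> k) = ?\<phi> g \<otimes>\<^bsub>BijGroup (range enc)\<^esub> ?\<phi> k"
      using Bij gk by (simp add: BijGroup_def)
  qed
  then have \<phi>: "group_hom G (BijGroup (range enc)) ?\<phi>"
    using G by (simp add: group_hom_def group_hom_axioms_def group_BijGroup)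
  have "inj_on ?\<phi> (carrier G)"
  proof (rule inj_onI)
    fix g k assume gk: "g \<in> carrier G" "k \<in> carrier G" and eq: "?\<phi> g = ?\<phi> k"
    have "magnus_act (h (inv\<^bsub>G\<^esub> k \<otimes>\<^bsub>G\<^esub> g)) p = p" for p
    proof -
      have "enc (magnus_act (h (inv\<^bsub>G\<^esub> k \<otimes>\<^bsub>G\<^esub> g)) p) = ?\<phi> (inv\<^bsub>G\<^esub> k \<otimes>\<^bsub>G\<^esub> g) (enc p)"
        by (simp only: app)
      also have "\<dots> = ?\<phi> (inv\<^bsub>G\<^esub> k) (?\<phi> k (enc p))"
        using mult[of "inv\<^bsub>G\<^esub> k" g p] gk eq by simp
      also have "\<dots> = enc p"
        using mult[of "inv\<^bsub>G\<^esub> k" k p] gk one by simp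
      finally show ?thesis using enc by (simp add: inj_eq)
    qed
    then have "h (inv\<^bsub>G\<^esub> k \<otimes>\<^bsub>G\<^esub> g) = h \<one>\<^bsub>G\<^esub>"
      using magnus_act_faithful H.hom_one by simp
    then have "inv\<^bsub>G\<^esub> k \<otimes>\<^bsub>G\<^esub> g = \<one>\<^bsub>G\<^esub>"
      by (rule inj_onD[OF inj]) (use gk in auto)
    then show "g = k"
      using gk H.G.inv_solve_left'[of "\<one>\<^bsub>G\<^esub>" k g] by simp
  qed
  then show ?thesis
    using \<phi> by (simp add: faithful_G_set_def faithful_action_def group_action_def faithful_action_axioms_def)
qed

text \<open>Sizes are sup norms, which are subadditive under multiplication because
  \<open>shift\<close> merely relocates coefficients. The radius thus grows linearly with word
  length.\<close>

definition magnus_box :: "nat \<Rightarrow> nat \<Rightarrow> ((nat \<times> (nat \<Rightarrow>\<^sub>0 int) \<Rightarrow>\<^sub>0 int) \<times> (nat \<Rightarrow>\<^sub>0 int)) set" where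
  "magnus_box d r = {u. (\<forall>e. \<bar>Poly_Mapping.lookup (fst u) e\<bar> \<le> int r) \<and>
     (\<forall>i. \<bar>Poly_Mapping.lookup (snd u) i\<bar> \<le> int r) \<and> Poly_Mapping.keys (snd u) \<subseteq> {1..d}}"

lemma magnus_box_mult:
  assumes "u \<in> magnus_box d r" "v \<in> magnus_box d s"
  shows "u \<otimes>\<^bsub>magnus_group\<^esub> v \<in> magnus_box d (r + s)"
proof -
  note u = assms(1)[unfolded magnus_box_def mem_Collect_eq]
  note v = assms(2)[unfolded magnus_box_def mem_Collect_eq]
  have "\<bar>Poly_Mapping.lookup (fst u + shift (snd u) (fst v)) e\<bar> \<le> int (r + s)" for e
  proof (cases e)
    case (Pair j c)
    show ?thesis
      unfolding Pair lookup_add lookup_shift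
      using u[THEN conjunct1, rule_format, of "(j, c)"]
        v[THEN conjunct1, rule_format, of "(j, c - snd u)"] by linarith
  qed
  moreover have "\<bar>Poly_Mapping.lookup (snd u + snd v) i\<bar> \<le> int (r + s)" for i
    unfolding lookup_add
    using u[THEN conjunct2, THEN conjunct1, rule_format, of i]
      v[THEN conjunct2, THEN conjunct1, rule_format, of i] by linarith
  moreover have "Poly_Mapping.keys (snd u + snd v) \<subseteq> {1..d}"
    by (rule subset_trans[OF keys_add Un_least[OF u[THEN conjunct2, THEN conjunct2]
          v[THEN conjunct2, THEN conjunct2]]])
  ultimately show ?thesis
    unfolding magnus_box_def magnus_simps
    by (intro CollectI conjI allI) (simp_all only: fst_conv snd_conv)
qed

lemma magnus_box_mono: "r \<le> s \<Longrightarrow> magnus_box d r \<subseteq> magnus_box d s"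
  unfolding magnus_box_def
proof (intro Collect_mono impI)
  fix u :: "(nat \<times> (nat \<Rightarrow>\<^sub>0 int) \<Rightarrow>\<^sub>0 int) \<times> (nat \<Rightarrow>\<^sub>0 int)"
  assume "r \<le> s" and u: "(\<forall>e. \<bar>Poly_Mapping.lookup (fst u) e\<bar> \<le> int r) \<and>
    (\<forall>i. \<bar>Poly_Mapping.lookup (snd u) i\<bar> \<le> int r) \<and> Poly_Mapping.keys (snd u) \<subseteq> {1..d}"
  have "x \<le> int s" if "x \<le> int r" for x
    using that \<open>r \<le> s\<close> by linarith
  then show "(\<forall>e. \<bar>Poly_Mapping.lookup (fst u) e\<bar> \<le> int s) \<and>
    (\<forall>i. \<bar>Poly_Mapping.lookup (snd u) i\<bar> \<le> int s) \<and> Poly_Mapping.keys (snd u) \<subseteq> {1..d}"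
    using u by blast
qed

lemma lookup_bounded: "\<exists>r. \<forall>e. \<bar>Poly_Mapping.lookup (f :: 'e \<Rightarrow>\<^sub>0 int) e\<bar> \<le> int r"
proof -
  have "\<bar>Poly_Mapping.lookup f e\<bar> \<le> int (\<Sum>e\<in>Poly_Mapping.keys f. nat \<bar>Poly_Mapping.lookup f e\<bar>)" for e
  proof (cases "e \<in> Poly_Mapping.keys f")
    case True
    then have "nat \<bar>Poly_Mapping.lookup f e\<bar> \<le> (\<Sum>e\<in>Poly_Mapping.keys f. nat \<bar>Poly_Mapping.lookup f e\<bar>)"
      by (intro member_le_sum) auto
    then show ?thesis by linarith
  qed (simp add: in_keys_iff)
  then show ?thesis by blast
qed

lemma exists_magnus_box:
  assumes "Poly_Mapping.keys (snd u) \<subseteq> {1..d}"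
  shows "\<exists>r. u \<in> magnus_box d r"
proof -
  obtain r where r: "\<And>e. \<bar>Poly_Mapping.lookup (fst u) e\<bar> \<le> int r"
    using lookup_bounded by blast
  obtain s where s: "\<And>i. \<bar>Poly_Mapping.lookup (snd u) i\<bar> \<le> int s"
    using lookup_bounded by blast
  have "\<bar>Poly_Mapping.lookup (fst u) e\<bar> \<le> int (r + s)" for e using r[of e] by simp
  moreover have "\<bar>Poly_Mapping.lookup (snd u) i\<bar> \<le> int (r + s)" for i using s[of i] by simp
  ultimately have "u \<in> magnus_box d (r + s)"
    using assms unfolding magnus_box_def by blast
  then show ?thesis ..
qed

lemma card_frag_box:
  fixes d r :: nat
  defines "V \<equiv> {a :: nat \<Rightarrow>\<^sub>0 int. Poly_Mapping.keys a \<subseteq> {1..d} \<and> (\<forall>i. \<bar>Poly_Mapping.lookup a i\<bar> \<le> int r)}"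
  shows "finite V" "card V \<le> (2 * r + 1) ^ d"
proof -
  let ?R = "\<lambda>a :: nat \<Rightarrow>\<^sub>0 int. restrict (Poly_Mapping.lookup a) {1..d}"
  let ?T = "{1..d} \<rightarrow>\<^sub>E {- int r..int r}"
  have inj: "inj_on ?R V"
  proof (rule inj_onI)
    fix a b assume ab: "a \<in> V" "b \<in> V" and eq: "?R a = ?R b"
    show "a = b"
    proof (rule poly_mapping_eqI)
      fix i
      show "Poly_Mapping.lookup a i = Poly_Mapping.lookup b i"
      proof (cases "i \<in> {1..d}")
        case True
        then show ?thesis using fun_cong[OF eq, of i] by simp
      next
        case False
        then have "i \<notin> Poly_Mapping.keys a" "i \<notin> Poly_Mapping.keys b"
          using ab by (auto simp: V_def)
        then show ?thesis by (simp add: in_keys_iff)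
      qed
    qed
  qed
  have sub: "?R ` V \<subseteq> ?T"
    by (auto simp: V_def abs_le_iff minus_le_iff)
  have card_int: "card {- int r..int r} = 2 * r + 1" by simp
  have fin: "finite ?T" by (intro finite_PiE) auto
  show "finite V"
    using inj_on_finite[OF inj sub fin] .
  have "card V \<le> card ?T"
    using inj sub fin by (rule card_inj_on_le)
  also have "card ?T = (2 * r + 1) ^ d"
    using card_int by (simp add: card_PiE)
  finally show "card V \<le> (2 * r + 1) ^ d" .
qed

text \<open>The image of \<open>p\<close> is determined by the vector and a single coefficient of
  the chain, that is, by \<open>d + 1\<close> integers of absolute value at most
  \<open>r\<close>.\<close>

lemma card_orbit_box:
  assumes "\<And>u. u \<in> U \<Longrightarrow> u \<in> magnus_box d r"
  shows "card ((\<lambda>u. magnus_act u p) ` U) \<le> (2 * r + 1) ^ (d + 1)"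
proof (cases p)
  case (fields j k c)
  let ?V = "{a :: nat \<Rightarrow>\<^sub>0 int. Poly_Mapping.keys a \<subseteq> {1..d} \<and> (\<forall>i. \<bar>Poly_Mapping.lookup a i\<bar> \<le> int r)}"
  let ?f = "\<lambda>(l, a). (j, k + l, c + a)"
  have "(\<lambda>u. magnus_act u p) ` U \<subseteq> ?f ` ({- int r..int r} \<times> ?V)"
  proof (rule image_subsetI)
    fix u assume "u \<in> U"
    then have u: "u \<in> magnus_box d r" by (rule assms)
    have "magnus_act u p = ?f (Poly_Mapping.lookup (fst u) (j, c + snd u), snd u)"
      by (simp add: fields magnus_act_def)
    moreover have "(Poly_Mapping.lookup (fst u) (j, c + snd u), snd u) \<in> {- int r..int r} \<times> ?V"
      using u by (auto simp: magnus_box_def abs_le_iff minus_le_iff)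
    ultimately show "magnus_act u p \<in> ?f ` ({- int r..int r} \<times> ?V)" by blast
  qed
  then have "card ((\<lambda>u. magnus_act u p) ` U) \<le> card (?f ` ({- int r..int r} \<times> ?V))"
    by (intro card_mono finite_imageI finite_cartesian_product card_frag_box) auto
  also have "\<dots> \<le> card ({- int r..int r} \<times> ?V)"
    by (intro card_image_le finite_cartesian_product card_frag_box) auto
  also have "\<dots> = (2 * r + 1) * card ?V"
  proof -
    have "card {- int r..int r} = 2 * r + 1" by simp
    then show ?thesis by (simp only: card_cartesian_product)
  qed
  also have "\<dots> \<le> (2 * r + 1) * (2 * r + 1) ^ d"
    by (intro mult_left_mono card_frag_box) auto
  finally show ?thesis by simp
qed

lemma transported_act_growth:
  assumes S: "finite_symmetric_generating_set G S" and G: "group G"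
    and h: "h \<in> hom G magnus_group" and enc: "inj enc"
    and keys: "\<And>g. g \<in> carrier G \<Longrightarrow> Poly_Mapping.keys (snd (h g)) \<subseteq> {1..d}"
  shows "asymp_le (\<lambda>n. real (vol G S (range enc) (transported_act h enc) n)) (\<lambda>n. real n ^ (d + 1))"
proof -
  interpret sym_gen_group G S
    using G S by (simp add: sym_gen_group_def sym_gen_group_axioms_def)
  interpret H: group_hom G magnus_group h
    using h G by (simp add: group_hom_def group_hom_axioms_def group_magnus_group)
  have "\<exists>r. \<forall>s\<in>S. h s \<in> magnus_box d r"
    using fin_S S_subset
  proof (induction S rule: finite_induct)
    case (insert s S)
    then obtain r where r: "\<forall>s\<in>S. h s \<in> magnus_box d r" by auto
    obtain r' where r': "h s \<in> magnus_box d r'"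
      using exists_magnus_box keys insert by (metis insert_subset)
    show ?case
      using r r' magnus_box_mono[of r "max r r'" d] magnus_box_mono[of r' "max r r'" d]
      by (intro exI[of _ "max r r'"]) auto
  qed simp
  then obtain r where r: "\<And>s. s \<in> S \<Longrightarrow> h s \<in> magnus_box d r" by blast
  have word: "set w \<subseteq> S \<Longrightarrow> h (foldr (\<lambda>s x. s \<otimes>\<^bsub>G\<^esub> x) w \<one>\<^bsub>G\<^esub>) \<in> magnus_box d (length w * r)" for w
  proof (induction w)
    case Nil
    then show ?case by (simp add: magnus_box_def)
  next
    case (Cons s w)
    have "foldr (\<lambda>s x. s \<otimes>\<^bsub>G\<^esub> x) w \<one>\<^bsub>G\<^esub> \<in> carrier G" "s \<in> carrier G"
      using S_subset Cons.prems by (auto intro!: word_product_closed)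
    then show ?case
      using magnus_box_mult[of "h s" d r _ "length w * r"] Cons r by (simp del: magnus_simps(3))
  qed
  have box: "h g \<in> magnus_box d (n * r)" if g: "g \<in> ball n" for g n
  proof -
    obtain w where w: "set w \<subseteq> S" "length w \<le> n" "g = foldr (\<lambda>s x. s \<otimes>\<^bsub>G\<^esub> x) w \<one>\<^bsub>G\<^esub>"
      using g by (auto simp: word_ball_def)
    have "magnus_box d (length w * r) \<subseteq> magnus_box d (n * r)"
      using w(2) by (intro magnus_box_mono mult_right_mono) auto
    then show ?thesis using word[OF w(1)] w(3) by blast
  qed
  \<comment> \<open>Chosen so that \<open>2 * (n * r) + 1 <= C * n\<close> for all
    \<open>n >= 1\<close>.\<close>
  define C where "C = 2 * r + 1"
  have "vol G S (range enc) (transported_act h enc) n \<le> C * (C * n) ^ (d + 1)" if n: "1 \<le> n" for n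
  proof -
    have "vol G S (range enc) (transported_act h enc) n \<le> (2 * (n * r) + 1) ^ (d + 1)"
    proof (rule vol_le)
      fix y assume "y \<in> range enc"
      then obtain p where y: "y = enc p" by blast
      have "(\<lambda>g. transported_act h enc g y) ` ball n = enc ` (\<lambda>u. magnus_act u p) ` h ` ball n"
        by (simp add: y transported_act_apply[OF enc] image_image)
      then have "card ((\<lambda>g. transported_act h enc g y) ` ball n) = card ((\<lambda>u. magnus_act u p) ` h ` ball n)"
        using card_image[OF inj_on_subset[OF enc subset_UNIV]] by simp
      also have "\<dots> \<le> (2 * (n * r) + 1) ^ (d + 1)"
        by (rule card_orbit_box) (use box in auto)
      finally show "card ((\<lambda>g. transported_act h enc g y) ` ball n) \<le> (2 * (n * r) + 1) ^ (d + 1)" .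
    qed simp
    also have "\<dots> \<le> (C * n) ^ (d + 1)"
      using n by (intro power_mono) (auto simp: C_def algebra_simps)
    also have "\<dots> \<le> C * (C * n) ^ (d + 1)"
      by (simp add: C_def)
    finally show ?thesis .
  qed
  then have "real (vol G S (range enc) (transported_act h enc) n) \<le> real C * real (C * n) ^ (d + 1)" if "1 \<le> n" for n
    using that by (metis of_nat_le_iff of_nat_mult of_nat_power)
  then show ?thesis
    unfolding asymp_le_def eventually_sequentially by (intro exI[of _ C]) (auto simp: C_def)
qed

text \<open>The two paths around a square leave the origin along different edges; only one of them
  traverses \<open>(i, 0)\<close>.\<close>

lemma magnus_gen_neq_commute:
  "i \<noteq> j \<Longrightarrow> magnus_gen i \<otimes>\<^bsub>magnus_group\<^esub> magnus_gen j \<noteq> magnus_gen j \<otimes>\<^bsub>magnus_group\<^esub> magnus_gen i"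
proof
  assume ij: "i \<noteq> j"
    and "magnus_gen i \<otimes>\<^bsub>magnus_group\<^esub> magnus_gen j = magnus_gen j \<otimes>\<^bsub>magnus_group\<^esub> magnus_gen i"
  then have "frag_of (i, 0) + frag_of (j, frag_of i) = frag_of (j, 0) + frag_of (i, frag_of j)"
    by (simp add: magnus_gen_def)
  then have "Poly_Mapping.lookup (frag_of (i, 0) + frag_of (j, frag_of i)) (i, 0) =
      Poly_Mapping.lookup (frag_of (j, 0) + frag_of (i, frag_of j)) (i, 0 :: nat \<Rightarrow>\<^sub>0 int)"
    by (rule arg_cong)
  then show False
    using ij frag_of_nonzero[of j] by (auto simp: lookup_add split: if_splits)
qed

theorem theorem6p17:
  fixes d :: nat and G :: "(nat \<times> bool) list set monoid"
  assumes "d \<ge> 2" and "G = free_metabelian_group d"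
  shows "(\<forall>m \<in> derived G (carrier G). m \<noteq> \<one>\<^bsub>G\<^esub> \<longrightarrow>
            non_foldable TYPE('x) G (m # map (free_metabelian_gen d) [1..<d+1]))
       \<and> schreier_growth_gap TYPE('x) G (\<lambda>n. real n ^ (d + 1))
       \<and> (\<exists>(E :: nat set) \<phi>. faithful_G_set G E \<phi> \<and>
            (\<forall>S. finite_symmetric_generating_set G S \<longrightarrow>
               asymp_eq (\<lambda>n. real (vol G S E \<phi> n)) (\<lambda>n. real n ^ (d + 1))))"
proof -
  let ?x = "free_metabelian_gen d"
  note facts = free_metabelian_group_magnus[of d, folded assms(2)]
  have G: "group G" unfolding assms(2) by (rule group_free_metabelian_group)
  interpret group G by (rule G)
  have fg: "finitely_generated G"
    unfolding assms(2) by (rule finitely_generated_free_metabelian_group)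
  obtain h where h: "h \<in> hom G magnus_group" "inj_on h (carrier G)"
    and hx: "\<And>i. i \<in> {1..d} \<Longrightarrow> h (?x i) = magnus_gen i"
    using facts(4) by blast
  interpret H: group_hom G magnus_group h
    using h G by (simp add: group_hom_def group_hom_axioms_def group_magnus_group)
  have x: "?x i \<in> carrier G \<and> snd (h (?x i)) = frag_of i" if "i \<in> {1..d}" for i
    using facts(1) hx[OF that] that by (auto simp: magnus_gen_def)
  \<comment> \<open>The point type is kept generic, since \<open>gap\<close> is later used both at
    \<open>'x\<close> and at \<open>nat\<close>.\<close>
  have nf: "non_foldable TYPE('y) G (m # map ?x [1..<d + 1])"
    if "m \<in> derived G (carrier G)" "m \<noteq> \<one>\<^bsub>G\<^esub>" for m
    using derived_subset_magnus_kernel[OF G h(1)] that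
    by (intro non_foldable_magnus[OF G h x]) auto

  have "1 \<in> {1..d}" "2 \<in> {1..d}" using assms(1) by auto
  \<comment> \<open>A commutator of two generators witnesses that the derived subgroup is
    non-trivial; this is where \<open>d >= 2\<close> enters.\<close>
  define m where "m = ?x 1 \<otimes>\<^bsub>G\<^esub> ?x 2 \<otimes>\<^bsub>G\<^esub> inv\<^bsub>G\<^esub> ?x 1 \<otimes>\<^bsub>G\<^esub> inv\<^bsub>G\<^esub> ?x 2"
  have x12: "?x 1 \<in> carrier G" "?x 2 \<in> carrier G"
    using x \<open>1 \<in> {1..d}\<close> \<open>2 \<in> {1..d}\<close> by blast+
  have m: "m \<in> derived G (carrier G)"
    unfolding derived_def m_def using x12 by (intro generate.incl) blast
  have "m \<noteq> \<one>\<^bsub>G\<^esub>"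
  proof
    assume "m = \<one>\<^bsub>G\<^esub>"
    then have "?x 1 \<otimes>\<^bsub>G\<^esub> ?x 2 \<otimes>\<^bsub>G\<^esub> inv\<^bsub>G\<^esub> (?x 2 \<otimes>\<^bsub>G\<^esub> ?x 1) = \<one>\<^bsub>G\<^esub>"
      using x12 by (simp add: m_def inv_mult_group m_assoc)
    then have "?x 1 \<otimes>\<^bsub>G\<^esub> ?x 2 = ?x 2 \<otimes>\<^bsub>G\<^esub> ?x 1"
      using x12 inv_solve_right'[of "\<one>\<^bsub>G\<^esub>" "?x 1 \<otimes>\<^bsub>G\<^esub> ?x 2" "?x 2 \<otimes>\<^bsub>G\<^esub> ?x 1"] by simp
    then have "magnus_gen 1 \<otimes>\<^bsub>magnus_group\<^esub> magnus_gen 2 = magnus_gen 2 \<otimes>\<^bsub>magnus_group\<^esub> magnus_gen 1"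
      using H.hom_mult[OF x12] H.hom_mult[OF x12(2,1)] hx \<open>1 \<in> {1..d}\<close> \<open>2 \<in> {1..d}\<close> by metis
    then show False using magnus_gen_neq_commute[of 1 2] by simp
  qed
  have gs: "set (m # map ?x [1..<d + 1]) \<subseteq> carrier G"
    using derived_in_carrier[of "carrier G"] m x by auto
  have gap: "schreier_growth_gap TYPE('y) G (\<lambda>n. real n ^ (d + 1))"
  proof -
    have "length (m # map ?x [1..<d + 1]) = d + 1" by simp
    moreover have "non_foldable TYPE('y) G (m # map ?x [1..<d + 1])"
      using m \<open>m \<noteq> \<one>\<^bsub>G\<^esub>\<close> by (rule nf)
    ultimately show ?thesis
      using non_foldable_growth_gap[OF fg gs, where 'x = 'y] by (simp only:)
  qed

  \<comment> \<open>All vectors are supported in \<open>{1..d}\<close>, so they contribute only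
    \<open>d\<close> dimensions to the orbit count.\<close>
  have "generate G (?x ` {1..d}) \<subseteq> {g \<in> carrier G. Poly_Mapping.keys (snd (h g)) \<subseteq> {1..d}}"
  proof (rule generate_subgroup_incl)
    show "?x ` {1..d} \<subseteq> {g \<in> carrier G. Poly_Mapping.keys (snd (h g)) \<subseteq> {1..d}}"
      using x by auto
    show "subgroup {g \<in> carrier G. Poly_Mapping.keys (snd (h g)) \<subseteq> {1..d}} G"
    proof (rule subgroupI)
      show "g \<otimes>\<^bsub>G\<^esub> k \<in> {g \<in> carrier G. Poly_Mapping.keys (snd (h g)) \<subseteq> {1..d}}"
        if "g \<in> {g \<in> carrier G. Poly_Mapping.keys (snd (h g)) \<subseteq> {1..d}}"
          "k \<in> {g \<in> carrier G. Poly_Mapping.keys (snd (h g)) \<subseteq> {1..d}}" for g k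
        using that keys_add[of "snd (h g)" "snd (h k)"] by auto
    qed (auto simp: inv_magnus intro!: exI[of _ "\<one>\<^bsub>G\<^esub>"])
  qed
  then have keys: "Poly_Mapping.keys (snd (h g)) \<subseteq> {1..d}" if "g \<in> carrier G" for g
    using facts(2) that by blast
  obtain enc :: "nat \<times> int \<times> (nat \<Rightarrow>\<^sub>0 int) \<Rightarrow> nat" where enc: "inj enc"
    using exists_point_encoding by blast
  let ?E = "range enc" and ?\<phi> = "transported_act h enc"
  have faithful: "faithful_G_set G ?E ?\<phi>"
    by (rule faithful_transported_act[OF G h enc])
  have "asymp_eq (\<lambda>n. real (vol G S ?E ?\<phi> n)) (\<lambda>n. real n ^ (d + 1))"
    if S: "finite_symmetric_generating_set G S" for S
    unfolding asymp_eq_def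
    using transported_act_growth[OF S G h(1) enc keys] gap S faithful
    unfolding schreier_growth_gap_def by blast
  then show ?thesis
    using nf gap faithful by blast
qed

end
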